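(* Let $G$ be a simple graph with $n\geq 2$ vertices and $e$ edges. Then \[\left\lceil \frac{e}{n-1}\right\rceil \leq \theta(4,G\bowtie G)\leq \theta(\infty,G).\]
   Context: The girth of a graph is the length of its shortest cycle, or $\infty$ if it is acyclic. For $g\ge 3$ (or $g=\infty$), the $g$-girth-thickness $\theta(g,H)$ of a graph $H$ is the minimum number of planar subgraphs of girth at least $g$ whose union is $H$. In particular $\theta(\infty,H)$ is the arboricity of $H$ (the minimum number of acyclic subgraphs whose union is $H$). For a simple graph $G$ with vertex set $\{w_1,\dots,w_n\}$, the graph $G\bowtie G$ has vertex set $\{u_1,\dots,u_n,v_1,\dots,v_n\}$, and for $x,y\in\{u,v\}$ the vertices $x_i$ and $y_j$ are adjacent if and only if $w_iw_j$ is an edge of $G$. *)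

theory Defs
  imports "HOL-Analysis.Analysis" "HOL-Library.Extended_Nat"
begin

record 'a graph =
  verts :: "'a set"
  edges :: "'a set set"

definition simple_graph :: "'a graph \<Rightarrow> bool" where
  "simple_graph G \<longleftrightarrow> finite (verts G) \<and> (\<forall>e\<in>edges G. e \<subseteq> verts G \<and> card e = 2)"

definition subgraph :: "'a graph \<Rightarrow> 'a graph \<Rightarrow> bool" where
  "subgraph H G \<longleftrightarrow> simple_graph H \<and> verts H \<subseteq> verts G \<and> edges H \<subseteq> edges G"

definition is_cycle :: "'a graph \<Rightarrow> 'a list \<Rightarrow> bool" where
  "is_cycle G c \<longleftrightarrow> 3 \<le> length c \<and> distinct c \<and>
     (\<forall>i<length c. {c ! i, c ! (Suc i mod length c)} \<in> edges G)"

text \<open>In \<^typ>\<open>enat\<close> the infimum of the empty set is \<open>\<infinity>\<close>, the girth of an acyclic graph.\<close>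

definition girth :: "'a graph \<Rightarrow> enat" where
  "girth G = (INF c\<in>{c. is_cycle G c}. enat (length c))"

text \<open>A drawing in the plane without crossings: vertices are distinct points, the edge
  \<open>e = {x, y}\<close> is a simple arc \<open>\<gamma> e\<close> joining the points of \<open>x\<close> and \<open>y\<close> and passing through no
  other vertex, and distinct arcs meet at most in the point of a common end vertex.\<close>

definition plane_drawing ::
    "'a graph \<Rightarrow> ('a \<Rightarrow> complex) \<Rightarrow> ('a set \<Rightarrow> real \<Rightarrow> complex) \<Rightarrow> bool" where
  "plane_drawing G p \<gamma> \<longleftrightarrow>
     inj_on p (verts G) \<and>
     (\<forall>e\<in>edges G. arc (\<gamma> e) \<and> {pathstart (\<gamma> e), pathfinish (\<gamma> e)} = p ` e \<and>
        path_image (\<gamma> e) \<inter> p ` verts G = p ` e) \<and>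
     (\<forall>e\<in>edges G. \<forall>f\<in>edges G. e \<noteq> f \<longrightarrow>
        path_image (\<gamma> e) \<inter> path_image (\<gamma> f) \<subseteq> p ` (e \<inter> f))"

definition planar :: "'a graph \<Rightarrow> bool" where
  "planar G \<longleftrightarrow> (\<exists>p \<gamma>. plane_drawing G p \<gamma>)"

text \<open>The least number is attained for every simple graph \<open>G\<close>: the subgraphs consisting of a single
  vertex or of a single edge with its ends are planar and acyclic, and their union is \<open>G\<close>.\<close>

definition girth_thickness :: "enat \<Rightarrow> 'a graph \<Rightarrow> nat" where
  "girth_thickness g G = (LEAST k. \<exists>\<H>. finite \<H> \<and> card \<H> = k \<and>
     (\<forall>H\<in>\<H>. subgraph H G \<and> planar H \<and> g \<le> girth H) \<and>
     (\<Union>H\<in>\<H>. verts H) = verts G \<and> (\<Union>H\<in>\<H>. edges H) = edges G)"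

text \<open>The graph \<open>G \<bowtie> G\<close>: the vertices \<open>(w, True)\<close> and \<open>(w, False)\<close> are the two copies
  \<open>u\<close> and \<open>v\<close> of the vertex \<open>w\<close>.\<close>

definition bowtie :: "'a graph \<Rightarrow> ('a \<times> bool) graph" where
  "bowtie G = \<lparr> verts = verts G \<times> UNIV,
                edges = {{(a, x), (b, y)} | a b x y. {a, b} \<in> edges G} \<rparr>"

end

theory Submission
  imports Defs
begin

text \<open>Lower bound. A plane graph of girth at least \<open>4\<close> on \<open>N \<ge> 4\<close> vertices has at most \<open>2N - 4\<close>
  edges, and \<open>G \<bowtie> G\<close> has \<open>2n\<close> vertices and \<open>4e\<close> edges. The bound is the usual Euler
  count, performed on the drawn arcs after deleting the \<open>b\<close> bridges. Let \<open>T\<close> be a maximal forest; it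
  contains all bridges, so at most \<open>N - 1 - b\<close> edges of \<open>T\<close> remain, and they do not separate the plane
  (Janiszewski). Each further edge closes a cycle and creates a face (Jordan). Conversely, an
  edge on a closed curve \<open>C\<close> touches at most two faces, since two faces on the same side of \<open>C\<close> are not
  separated by \<open>C\<close>, nor by the rest of the drawing, and these two sets meet in a connected set
  (Janiszewski again). The edges touched by a face contain a cycle, hence number at least four, for
  otherwise they form a forest, which has a connected complement.

  Upper bound. If \<open>F\<close> is a forest then \<open>F \<bowtie> F\<close> has no triangle, and it has a straight-line drawing
  even together with the edges \<open>u\<^sub>w v\<^sub>w\<close>: a leaf \<open>w\<close> at \<open>x\<close> is added by placing both copies of \<open>w\<close> in a
  thin triangle over the segment from \<open>u\<^sub>x\<close> to \<open>v\<^sub>x\<close>.\<close>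

section \<open>Cycles and forests\<close>

text \<open>The condition of \<open>is_cycle\<close> on a bare edge set, because the counting
  argument deletes bridges and inserts edges while the vertices stay fixed.\<close>

definition cycle_in :: "'a set set \<Rightarrow> 'a list \<Rightarrow> bool" where
  "cycle_in E c \<longleftrightarrow> 3 \<le> length c \<and> distinct c \<and>
     (\<forall>i<length c. {c ! i, c ! (Suc i mod length c)} \<in> E)"

definition cycle_edges :: "'a list \<Rightarrow> 'a set set" where
  "cycle_edges c = (\<lambda>i. {c ! i, c ! (Suc i mod length c)}) ` {..<length c}"

definition acyclic_edges :: "'a set set \<Rightarrow> bool" where
  "acyclic_edges E \<longleftrightarrow> (\<nexists>c. cycle_in E c)"

fun path_edges :: "'a list \<Rightarrow> 'a set set" where
  "path_edges (x # y # xs) = insert {x, y} (path_edges (y # xs))"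
| "path_edges _ = {}"

lemma is_cycle_iff_cycle_in: "is_cycle G c \<longleftrightarrow> cycle_in (edges G) c"
  by (simp add: is_cycle_def cycle_in_def)

lemma cycle_in_iff: "cycle_in E c \<longleftrightarrow> 3 \<le> length c \<and> distinct c \<and> cycle_edges c \<subseteq> E"
  by (auto simp: cycle_in_def cycle_edges_def)

lemma acyclic_edges_subset: "acyclic_edges E \<Longrightarrow> F \<subseteq> E \<Longrightarrow> acyclic_edges F"
  by (fastforce simp: acyclic_edges_def cycle_in_iff)

lemma path_edges_conv_nth: "path_edges xs = {{xs ! i, xs ! Suc i} | i. Suc i < length xs}"
proof (induction xs rule: path_edges.induct)
  case (1 x y xs)
  have "{{(x # y # xs) ! i, (x # y # xs) ! Suc i} | i. Suc i < length (x # y # xs)}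
      = insert {x, y} {{(y # xs) ! i, (y # xs) ! Suc i} | i. Suc i < length (y # xs)}"
    (is "?L = ?R")
  proof (intro equalityI subsetI)
    fix e assume "e \<in> ?L"
    then obtain i where "e = {(x # y # xs) ! i, (x # y # xs) ! Suc i}" "Suc i < length (x # y # xs)"
      by blast
    then show "e \<in> ?R" by (cases i) auto
  next
    fix e assume "e \<in> ?R"
    then consider "e = {x, y}" | i where "e = {(y # xs) ! i, (y # xs) ! Suc i}" "Suc i < length (y # xs)"
      by blast
    then show "e \<in> ?L"
    proof cases
      case 1
      then show ?thesis by (auto intro!: exI[of _ 0])
    next
      case (2 i)
      then show ?thesis by (auto intro!: exI[of _ "Suc i"])
    qed
  qed
  with 1 show ?case by simp
qed auto

lemma path_edges_take: "path_edges (take n xs) \<subseteq> path_edges xs"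
  by (auto simp: path_edges_conv_nth)

lemma path_edges_subset: "e \<in> path_edges xs \<Longrightarrow> e \<subseteq> set xs"
  by (auto simp: path_edges_conv_nth)

text \<open>This is where length at least 3 matters: modulo 2 two indices are successors of each
  other, and the edges of a closed walk could coincide.\<close>

lemma cycle_step_asym:
  assumes "i < n" "j < n" "3 \<le> n" "i = Suc j mod n"
  shows "Suc i mod n \<noteq> j"
  using assms by (auto simp: mod_Suc split: if_splits)

lemma inj_on_cycle_edge:
  assumes "3 \<le> length c" "distinct c"
  shows "inj_on (\<lambda>i. {c ! i, c ! (Suc i mod length c)}) {..<length c}"
proof (rule inj_onI)
  fix i j
  assume ij: "i \<in> {..<length c}" "j \<in> {..<length c}"
    and eq: "{c ! i, c ! (Suc i mod length c)} = {c ! j, c ! (Suc j mod length c)}"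
  have lt: "Suc i mod length c < length c" "Suc j mod length c < length c"
    using ij by (auto intro!: mod_less_divisor)
  have "i = j \<or> (i = Suc j mod length c \<and> Suc i mod length c = j)"
    using eq ij lt assms(2) by (auto simp: doubleton_eq_iff nth_eq_iff_index_eq)
  then show "i = j" using cycle_step_asym[of i "length c" j] ij assms by auto
qed

lemma card_cycle_edges:
  assumes "3 \<le> length c" "distinct c"
  shows "card (cycle_edges c) = length c"
  using card_image[OF inj_on_cycle_edge[OF assms]] by (simp add: cycle_edges_def)

text \<open>The cycle is cut open at \<open>e\<close>: rotating the list until \<open>e\<close>
  joins its last entry to its first leaves the other edges as a path.\<close>

lemma cycle_through_edge:
  assumes "cycle_in E c" "e \<in> cycle_edges c"
  obtains xs where "3 \<le> length xs" "distinct xs" "e = {hd xs, last xs}"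
    "path_edges xs \<subseteq> cycle_edges c - {e}"
proof -
  from assms(2) obtain i where i: "i < length c" "e = {c ! i, c ! (Suc i mod length c)}"
    by (auto simp: cycle_edges_def)
  define n where "n = length c"
  have c: "3 \<le> n" "distinct c" using assms(1) by (auto simp: cycle_in_def n_def)
  define xs where "xs = rotate (Suc i) c"
  have len: "length xs = n" by (simp add: xs_def n_def)
  have nth: "xs ! k = c ! ((Suc i + k) mod n)" if "k < n" for k
    using that unfolding xs_def n_def by (rule nth_rotate)
  have ne: "xs \<noteq> []" using len c by auto
  have "last xs = c ! ((Suc i + (n - 1)) mod n)"
    using ne c len by (simp add: last_conv_nth nth)
  also have "Suc i + (n - 1) = i + n" using c by simp
  also have "(i + n) mod n = i" using i by (simp add: n_def)
  finally have last: "last xs = c ! i" .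
  have hd: "hd xs = c ! (Suc i mod n)" using nth[of 0] ne c by (simp add: hd_conv_nth)
  have "f \<in> cycle_edges c - {e}" if "f \<in> path_edges xs" for f
  proof -
    from that obtain k where k: "f = {xs ! k, xs ! Suc k}" "Suc k < n"
      by (auto simp: path_edges_conv_nth len)
    define j where "j = (Suc i + k) mod n"
    have j: "j < n" using c by (simp add: j_def)
    have "f = {c ! j, c ! (Suc j mod n)}"
      using k by (simp add: nth j_def mod_Suc_eq)
    \<comment> \<open>As \<open>k\<close> stops at \<open>n - 2\<close>, the index
      \<open>Suc i + k\<close> does not come back to \<open>i\<close> modulo
      \<open>n\<close>.\<close>
    moreover have "j \<noteq> i"
      using k i by (auto simp: j_def n_def mod_if split: if_splits)
    ultimately show ?thesis
      using i j inj_on_cycle_edge[of c] c unfolding n_def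
      by (auto simp: cycle_edges_def inj_on_def)
  qed
  then have "path_edges xs \<subseteq> cycle_edges c - {e}" by blast
  moreover have "e = {hd xs, last xs}" using i last hd by (simp add: n_def insert_commute)
  moreover have "distinct xs" using c by (simp add: xs_def)
  ultimately show ?thesis using that[of xs] len c by simp
qed

lemma cycle_inI_path:
  assumes "3 \<le> length xs" "distinct xs" "path_edges xs \<subseteq> E" "{hd xs, last xs} \<in> E"
  shows "cycle_in E xs"
  unfolding cycle_in_def
proof (intro conjI allI impI assms(1,2))
  fix i assume i: "i < length xs"
  show "{xs ! i, xs ! (Suc i mod length xs)} \<in> E"
  proof (cases "Suc i < length xs")
    case True
    then show ?thesis using assms(3) by (auto simp: path_edges_conv_nth)
  next
    case False
    then have "Suc i = length xs" "xs \<noteq> []" using i by auto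
    then have "xs ! i = last xs" "xs ! (Suc i mod length xs) = hd xs"
      by (auto simp: last_conv_nth hd_conv_nth simp flip: \<open>Suc i = length xs\<close>)
    then show ?thesis using assms(4) by (simp add: insert_commute)
  qed
qed

text \<open>The first vertex of a longest path is a leaf: a second edge at it would either prolong
  the path or close a cycle.\<close>

lemma acyclic_edges_leaf:
  assumes fin: "finite E" and two: "\<forall>e\<in>E. card e = 2" and "E \<noteq> {}" and acyc: "acyclic_edges E"
  obtains w x where "w \<noteq> x" "{w, x} \<in> E" "\<forall>f\<in>E. w \<in> f \<longrightarrow> f = {w, x}"
proof -
  define P where "P xs \<longleftrightarrow> distinct xs \<and> 2 \<le> length xs \<and> path_edges xs \<subseteq> E" for xs
  have finV: "finite (\<Union>E)" using fin two by (metis card.infinite finite_Union zero_neq_numeral)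
  obtain e where "e \<in> E" using \<open>E \<noteq> {}\<close> by blast
  then obtain u v where "e = {u, v}" "u \<noteq> v" using two card_2_iff by metis
  then have P0: "P [u, v]" using \<open>e \<in> E\<close> by (simp add: P_def)
  have bound: "length xs \<le> card (\<Union>E)" if "P xs" for xs
  proof -
    have "x \<in> \<Union>E" if "x \<in> set xs" for x
    proof -
      from that obtain i where i: "i < length xs" "x = xs ! i" by (metis in_set_conv_nth)
      have "\<exists>f\<in>path_edges xs. x \<in> f"
      proof (cases "Suc i < length xs")
        case True
        then show ?thesis using i by (auto simp: path_edges_conv_nth)
      next
        case False
        then obtain j where "i = Suc j" using \<open>P xs\<close> by (cases i) (auto simp: P_def)
        then show ?thesis using i by (auto simp: path_edges_conv_nth intro!: exI[of _ "{xs ! j, xs ! i}"])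
      qed
      then show ?thesis using \<open>P xs\<close> by (auto simp: P_def)
    qed
    then have "card (set xs) \<le> card (\<Union>E)" using finV by (intro card_mono) auto
    then show ?thesis using \<open>P xs\<close> by (simp add: P_def distinct_card)
  qed
  obtain xs where xs: "P xs" and max: "\<And>ys. P ys \<Longrightarrow> length ys \<le> length xs"
    using ex_has_greatest_nat[of P _ length "Suc (card (\<Union>E))", OF P0] bound
    by (auto simp: less_Suc_eq_le)
  then obtain w x zs where eq: "xs = w # x # zs"
    by (cases xs rule: path_edges.cases) (auto simp: P_def)
  have wx: "w \<noteq> x" "{w, x} \<in> E" using xs eq by (auto simp: P_def)
  have "f = {w, x}" if f: "f \<in> E" "w \<in> f" for f
  proof (rule ccontr)
    assume neq: "f \<noteq> {w, x}"
    obtain z where z: "f = {w, z}" "z \<noteq> w"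
      using f two card_2_iff[of f] by (metis insertE insert_commute singletonD)
    show False
    proof (cases "z \<in> set xs")
      case False
      then have "P (z # xs)" using xs eq z f by (auto simp: P_def insert_commute)
      then show False using max by fastforce
    next
      case True
      then obtain j where j: "j < length xs" "z = xs ! j" by (metis in_set_conv_nth)
      \<comment> \<open>\<open>j = 0\<close> would make \<open>z = w\<close>, and
        \<open>j = 1\<close> would make \<open>f = {w, x}\<close>. So the prefix ending in
        \<open>z\<close> has at least three vertices, and \<open>f\<close> closes it to a
        cycle.\<close>
      have "j \<noteq> 0" "j \<noteq> 1" using j z neq eq by auto
      then have j2: "2 \<le> j" by linarith
      let ?ys = "take (Suc j) xs"
      have "cycle_in E ?ys"
      proof (rule cycle_inI_path)
        show "3 \<le> length ?ys" using j j2 by simp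
        show "distinct ?ys" using xs by (simp add: P_def)
        show "path_edges ?ys \<subseteq> E" using xs path_edges_take[of "Suc j" xs] by (auto simp: P_def)
        have "hd ?ys = w" using eq by simp
        moreover have "last ?ys = z" using j by (simp add: take_Suc_conv_app_nth)
        ultimately show "{hd ?ys, last ?ys} \<in> E" using f z by simp
      qed
      then show False using acyc by (auto simp: acyclic_edges_def)
    qed
  qed
  then show ?thesis using that wx by blast
qed

text \<open>Deleting a leaf together with its edge lowers both numbers by one, until no edge is
  left.\<close>

lemma acyclic_edges_card_less:
  assumes "finite V" "V \<noteq> {}" "\<forall>e\<in>E. e \<subseteq> V \<and> card e = 2" "acyclic_edges E"
  shows "card E < card V"
  using assms
proof (induction "card V" arbitrary: V E rule: less_induct)
  case less
  have finE: "finite E" using less.prems(1,3) finite_subset[of E "Pow V"] by blast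
  show ?case
  proof (cases "E = {}")
    case True
    then show ?thesis using less.prems by (simp add: card_gt_0_iff)
  next
    case False
    have two: "\<forall>e\<in>E. card e = 2" using less.prems(3) by blast
    obtain w x where w: "w \<noteq> x" "{w, x} \<in> E" "\<forall>f\<in>E. w \<in> f \<longrightarrow> f = {w, x}"
      by (rule acyclic_edges_leaf[OF finE two False less.prems(4)])
    have wV: "w \<in> V" "x \<in> V" using w(2) less.prems(3) by auto
    have "card (E - {{w, x}}) < card (V - {w})"
    proof (rule less.hyps)
      show "card (V - {w}) < card V" using wV less.prems(1) by (rule_tac card_Diff1_less) auto
      show "V - {w} \<noteq> {}" using wV w(1) by auto
      have "w \<notin> f" if "f \<in> E - {{w, x}}" for f using w(3) that by blast
      then show "\<forall>e\<in>E - {{w, x}}. e \<subseteq> V - {w} \<and> card e = 2" using less.prems(3) by blast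
      show "acyclic_edges (E - {{w, x}})" using less.prems(4) acyclic_edges_subset by blast
    qed (use less.prems in auto)
    then show ?thesis using w(2) wV finE less.prems(1) by (simp add: card_Diff_singleton)
  qed
qed

text \<open>Plays the role of a spanning forest. Taking an acyclic set of largest cardinality avoids
  any discussion of connectedness of the graph.\<close>

lemma maximal_acyclic_subset:
  fixes E :: "'a set set"
  assumes "finite E"
  obtains T where "T \<subseteq> E" "acyclic_edges T" "\<forall>e\<in>E - T. \<not> acyclic_edges (insert e T)"
proof -
  have "acyclic_edges ({}::'a set set)" 
    by (auto simp: acyclic_edges_def cycle_in_def intro!: exI[of _ 0])
  then have "{} \<subseteq> E \<and> acyclic_edges ({} :: 'a set set)" by simp
  from ex_has_greatest_nat[of "\<lambda>T. T \<subseteq> E \<and> acyclic_edges T", OF this, of card "Suc (card E)"]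
  obtain T where T: "T \<subseteq> E \<and> acyclic_edges T"
    and max: "\<And>U. U \<subseteq> E \<and> acyclic_edges U \<Longrightarrow> card U \<le> card T"
    using card_mono[OF assms] by (auto simp: less_Suc_eq_le)
  have "\<not> acyclic_edges (insert e T)" if "e \<in> E - T" for e
  proof
    assume "acyclic_edges (insert e T)"
    then have "card (insert e T) \<le> card T" using max T that by blast
    then show False using that T assms finite_subset by fastforce
  qed
  then show ?thesis using that T by blast
qed

section \<open>Edges of plane graphs without triangles\<close>

lemma connected_component_ballI:
  fixes m :: "'a::real_normed_vector"
  assumes "ball m r \<subseteq> S" "z \<in> ball m r"
  shows "connected_component S m z"
proof -
  have "m \<in> ball m r" using assms(2) le_less_trans[OF zero_le_dist] by auto
  then show ?thesis
    unfolding connected_component_def using assms convex_connected[OF convex_ball[of m r]]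
    by (intro exI[of _ "ball m r"]) simp
qed

locale plane_graph =
  fixes H :: "'a graph" and p :: "'a \<Rightarrow> complex" and \<gamma> :: "'a set \<Rightarrow> real \<Rightarrow> complex"
  assumes simple: "simple_graph H" and drawing: "plane_drawing H p \<gamma>"
begin

definition drawn :: "'a set set \<Rightarrow> complex set" where
  "drawn S = (\<Union>e\<in>S. path_image (\<gamma> e))"

definition open_edge :: "'a set \<Rightarrow> complex set" where
  "open_edge e = path_image (\<gamma> e) - p ` e"

lemma finite_verts: "finite (verts H)"
  using simple by (simp add: simple_graph_def)

lemma edge_subset: "e \<in> edges H \<Longrightarrow> e \<subseteq> verts H"
  using simple by (simp add: simple_graph_def)

lemma edge_card: "e \<in> edges H \<Longrightarrow> card e = 2"
  using simple by (simp add: simple_graph_def)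

lemma finite_edges: "finite (edges H)"
  using finite_verts edge_subset finite_subset[of "edges H" "Pow (verts H)"] by blast

lemma arc_edge: "e \<in> edges H \<Longrightarrow> arc (\<gamma> e)"
  using drawing by (simp add: plane_drawing_def)

lemma edge_ends: "e \<in> edges H \<Longrightarrow> {pathstart (\<gamma> e), pathfinish (\<gamma> e)} = p ` e"
  using drawing by (simp add: plane_drawing_def)

lemma edge_Int:
  "e \<in> edges H \<Longrightarrow> f \<in> edges H \<Longrightarrow> e \<noteq> f \<Longrightarrow>
     path_image (\<gamma> e) \<inter> path_image (\<gamma> f) \<subseteq> p ` (e \<inter> f)"
  using drawing by (simp add: plane_drawing_def)

lemma compact_drawn: "S \<subseteq> edges H \<Longrightarrow> compact (drawn S)"
  unfolding drawn_def using finite_edges arc_edge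
  by (intro compact_UN) (auto intro: finite_subset compact_path_image arc_imp_path)

lemma open_Compl_drawn: "S \<subseteq> edges H \<Longrightarrow> open (- drawn S)"
  using compact_drawn compact_imp_closed by blast

lemma open_edge_subset: "open_edge e \<subseteq> path_image (\<gamma> e)"
  by (auto simp: open_edge_def)

lemma open_edge_conv:
  "e \<in> edges H \<Longrightarrow> open_edge e = path_image (\<gamma> e) - {pathstart (\<gamma> e), pathfinish (\<gamma> e)}"
  by (simp add: open_edge_def edge_ends)

lemma connected_open_edge: "e \<in> edges H \<Longrightarrow> connected (open_edge e)"
  by (simp add: open_edge_conv connected_simple_path_endless arc_imp_simple_path arc_edge)

lemma open_edge_nonempty: "e \<in> edges H \<Longrightarrow> open_edge e \<noteq> {}"
  unfolding open_edge_conv by (rule nonempty_simple_path_endless) (simp add: arc_imp_simple_path arc_edge)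

lemma open_edge_disjoint:
  assumes "e \<in> edges H" "S \<subseteq> edges H" "e \<notin> S"
  shows "open_edge e \<inter> drawn S = {}"
proof -
  have "z \<in> p ` e" if "z \<in> path_image (\<gamma> e)" "f \<in> S" "z \<in> path_image (\<gamma> f)" for z f
    using edge_Int[of e f] that assms by blast
  then show ?thesis by (auto simp: open_edge_def drawn_def)
qed

lemma drawn_insert: "drawn (insert e S) = path_image (\<gamma> e) \<union> drawn S"
  by (simp add: drawn_def)

lemma drawn_mono: "S \<subseteq> T \<Longrightarrow> drawn S \<subseteq> drawn T"
  by (auto simp: drawn_def)

section \<open>Arcs along paths and closed curves along cycles\<close>

lemma oriented_edge_arc:
  assumes "{x, y} \<in> edges H"
  obtains g where "arc g" "pathstart g = p x" "pathfinish g = p y" "path_image g = path_image (\<gamma> {x, y})"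
proof (cases "pathstart (\<gamma> {x, y}) = p x")
  case True
  then have "pathfinish (\<gamma> {x, y}) = p y"
    using edge_ends[OF assms] by (auto simp: doubleton_eq_iff)
  then show ?thesis using that[of "\<gamma> {x, y}"] True arc_edge[OF assms] by blast
next
  \<comment> \<open>A drawing fixes only the unordered pair of end points, so the arc may run from
    \<open>y\<close> to \<open>x\<close> and is then reversed.\<close>
  case False
  then have "pathstart (\<gamma> {x, y}) = p y" "pathfinish (\<gamma> {x, y}) = p x"
    using edge_ends[OF assms] by (auto simp: doubleton_eq_iff)
  then show ?thesis using that[of "reversepath (\<gamma> {x, y})"] arc_edge[OF assms]
    by (simp add: arc_reversepath)
qed

text \<open>The arcs of consecutive edges are joined. Since the vertices are distinct,
  \<open>x\<close> lies on no later edge, so the first arc meets the rest only at the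
  junction.\<close>

lemma path_arc:
  assumes "2 \<le> length xs" "distinct xs" "path_edges xs \<subseteq> edges H"
  shows "\<exists>g. arc g \<and> pathstart g = p (hd xs) \<and> pathfinish g = p (last xs) \<and>
             path_image g = drawn (path_edges xs)"
  using assms
proof (induction xs rule: path_edges.induct)
  case (1 x y zs)
  have xy: "{x, y} \<in> edges H" using 1 by simp
  obtain g where g: "arc g" "pathstart g = p x" "pathfinish g = p y"
    "path_image g = path_image (\<gamma> {x, y})"
    by (rule oriented_edge_arc[OF xy])
  show ?case
  proof (cases "zs = []")
    case True
    then show ?thesis using g by (auto simp: drawn_def)
  next
    case False
    then have "2 \<le> length (y # zs)" by (cases zs) auto
    then obtain h where h: "arc h" "pathstart h = p y" "pathfinish h = p (last (y # zs))"
      "path_image h = drawn (path_edges (y # zs))"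
      using 1 by auto
    have "path_image g \<inter> path_image h \<subseteq> {pathstart h}"
    proof
      fix z assume z: "z \<in> path_image g \<inter> path_image h"
      then obtain f where f: "f \<in> path_edges (y # zs)" "z \<in> path_image (\<gamma> f)"
        using h by (auto simp: drawn_def)
      have "x \<notin> f" using path_edges_subset[OF f(1)] 1 by auto
      moreover have "z \<in> p ` ({x, y} \<inter> f)"
        using edge_Int[OF xy, of f] f z g 1 \<open>x \<notin> f\<close> by auto
      ultimately show "z \<in> {pathstart h}" using h by auto
    qed
    then have "arc (g +++ h)" using g h by (intro arc_join) auto
    then show ?thesis using g h False
      by (intro exI[of _ "g +++ h"]) (simp add: path_image_join drawn_insert)
  qed
qed auto

text \<open>The Jordan curve of the cycle is split into the edge \<open>e\<close> and the
  complementary arc \<open>P\<close>. Connectedness of \<open>P\<close> is recorded because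
  \<open>P\<close> will be the intersection of the curve with the drawing without \<open>e\<close>,
  as Janiszewski's theorem demands.\<close>

lemma cycle_curve:
  assumes "S \<subseteq> edges H" "cycle_in S c" "e \<in> cycle_edges c"
  obtains q P where "simple_path q" "pathfinish q = pathstart q"
    "path_image q = path_image (\<gamma> e) \<union> P" "connected P" "P \<subseteq> drawn (S - {e})" "p ` e \<subseteq> P"
proof -
  have cS: "cycle_edges c \<subseteq> S" using assms by (simp add: cycle_in_iff)
  have eH: "e \<in> edges H" using cS assms by blast
  obtain xs where xs: "3 \<le> length xs" "distinct xs" "e = {hd xs, last xs}"
    "path_edges xs \<subseteq> cycle_edges c - {e}"
    by (rule cycle_through_edge[OF assms(2,3)])
  then have "path_edges xs \<subseteq> edges H" using cS assms by blast
  then obtain g where g: "arc g" "pathstart g = p (hd xs)" "pathfinish g = p (last xs)"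
    "path_image g = drawn (path_edges xs)"
    using path_arc[of xs] xs by auto
  have "{last xs, hd xs} \<in> edges H" using eH xs by (simp add: insert_commute)
  then obtain h where h: "arc h" "pathstart h = p (last xs)" "pathfinish h = p (hd xs)"
    "path_image h = path_image (\<gamma> {last xs, hd xs})"
    by (rule oriented_edge_arc)
  have he: "path_image h = path_image (\<gamma> e)" using h xs by (simp add: insert_commute)
  have sub: "path_image g \<subseteq> drawn (S - {e})" using g xs cS by (auto simp: drawn_def)
  have "path_image g \<inter> path_image h \<subseteq> {pathstart g, pathstart h}"
  proof -
    have "open_edge e \<inter> drawn (S - {e}) = {}" using eH assms by (intro open_edge_disjoint) auto
    then show ?thesis using sub he g h xs by (auto simp: open_edge_def)
  qed
  then have "simple_path (g +++ h)" using g h by (intro simple_path_join_loop) auto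
  moreover have "path_image (g +++ h) = path_image (\<gamma> e) \<union> path_image g"
    using g h he by (simp add: path_image_join Un_commute)
  moreover have "p ` e \<subseteq> path_image g"
    using pathstart_in_path_image[of g] pathfinish_in_path_image[of g] g xs by auto
  ultimately show ?thesis
    using that[of "g +++ h" "path_image g"] g h sub connected_path_image[OF arc_imp_path[OF g(1)]]
    by simp
qed

section \<open>Forests do not separate the plane\<close>

lemma connected_Compl_drawn_acyclic:
  assumes "S \<subseteq> edges H" "acyclic_edges S"
  shows "connected (- drawn S)"
proof -
  have "finite S" using assms finite_edges finite_subset by blast
  then show ?thesis using assms
  proof (induction "card S" arbitrary: S rule: less_induct)
    case less
    show ?case
    proof (cases "S = {}")
      case True
      then show ?thesis by (simp add: drawn_def convex_connected)
    next
      case False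
      have two: "\<forall>e\<in>S. card e = 2" using less.prems edge_card by blast
      obtain w x where w: "w \<noteq> x" "{w, x} \<in> S" "\<forall>f\<in>S. w \<in> f \<longrightarrow> f = {w, x}"
        by (rule acyclic_edges_leaf[OF less.prems(1) two False less.prems(3)])
      let ?e = "{w, x}" and ?S = "S - {{w, x}}"
      have eH: "?e \<in> edges H" using w less.prems by blast
      have SH: "?S \<subseteq> edges H" using less.prems by blast
      have "card ?S < card S" by (rule card_Diff1_less[OF less.prems(1) w(2)])
      then have IH: "connected (- drawn ?S)"
        using less.hyps[of ?S] less.prems acyclic_edges_subset[of S ?S] by blast
      \<comment> \<open>No other edge contains the leaf \<open>w\<close>, so the arc of the leaf
        edge meets the rest at most in the point of \<open>x\<close>. Neither set separates the
        plane and their intersection is connected, hence their union does not separate it.\<close>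
      have "path_image (\<gamma> ?e) \<inter> drawn ?S \<subseteq> {p x}"
      proof
        fix z assume "z \<in> path_image (\<gamma> ?e) \<inter> drawn ?S"
        then obtain f where f: "f \<in> ?S" "z \<in> path_image (\<gamma> f)" "z \<in> path_image (\<gamma> ?e)"
          by (auto simp: drawn_def)
        then have "z \<in> p ` (?e \<inter> f)" using edge_Int[OF eH, of f] SH by blast
        moreover have "w \<notin> f" using w(3) f by blast
        ultimately show "z \<in> {p x}" by auto
      qed
      then have "connected (path_image (\<gamma> ?e) \<inter> drawn ?S)"
        by (metis connected_empty connected_sing subset_singletonD)
      then have "connected (- (path_image (\<gamma> ?e) \<union> drawn ?S))"
        using IH compact_drawn[OF SH] compact_imp_closed arc_edge[OF eH]
          connected_arc_complement[of "\<gamma> ?e"]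
        by (intro Janiszewski_connected) (auto intro: compact_path_image arc_imp_path)
      then show ?thesis using w(2) by (metis drawn_insert insert_Diff)
    qed
  qed
qed

text \<open>Points are added one at a time by Janiszewski's theorem, since a single point meets any
  set in the empty set or in itself. It serves for end points of edges that are themselves left
  out.\<close>

lemma connected_Compl_drawn_Un_finite:
  assumes "S \<subseteq> edges H" "acyclic_edges S" "finite A"
  shows "connected (- (drawn S \<union> A))"
  using assms(3)
proof induction
  case empty
  then show ?case using assms connected_Compl_drawn_acyclic by simp
next
  case (insert a A)
  have "connected (- ({a} \<union> (drawn S \<union> A)))"
  proof (rule Janiszewski_connected)
    show "closed (drawn S \<union> A)"
      using compact_imp_closed[OF compact_drawn[OF assms(1)]] finite_imp_closed[OF insert(1)] by blast
    have "{a} \<inter> (drawn S \<union> A) = {} \<or> {a} \<inter> (drawn S \<union> A) = {a}" by auto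
    then show "connected ({a} \<inter> (drawn S \<union> A))" by (metis connected_empty connected_sing)
    show "connected (- {a})"
      by (simp add: connected_punctured_universe)
  qed (use insert in auto)
  then show ?case by simp
qed

section \<open>Faces and the edges on their boundary\<close>

definition touches :: "complex set \<Rightarrow> 'a set \<Rightarrow> bool" where
  "touches f e \<longleftrightarrow> open_edge e \<inter> frontier f \<noteq> {}"

text \<open>The open edge runs within one face \<open>f0\<close> of \<open>S\<close>. A piece of
  \<open>f0\<close> survives on either side of the closed curve through \<open>e\<close>, and every
  other face survives whole. With finite families \<open>X\<close> of faces, finiteness of the set
  of all faces need not be known first.\<close>

lemma new_face:
  assumes SH: "S \<subseteq> edges H" and eH: "e \<in> edges H" "e \<notin> S"
    and cyc: "cycle_in (insert e S) c" "e \<in> cycle_edges c"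
    and X: "X \<subseteq> components (- drawn S)" "finite X"
  shows "\<exists>Y. Y \<subseteq> components (- drawn (insert e S)) \<and> finite Y \<and> Suc (card X) \<le> card Y"
proof -
  have "insert e S \<subseteq> edges H" using SH eH by blast
  then obtain q P where q: "simple_path q" "pathfinish q = pathstart q"
    "path_image q = path_image (\<gamma> e) \<union> P" "P \<subseteq> drawn (insert e S - {e})" "p ` e \<subseteq> P"
    using cycle_curve[OF _ cyc] by metis
  have PS: "P \<subseteq> drawn S" using q eH by simp
  let ?C = "path_image q" and ?U = "- drawn (insert e S)"
  note J = Jordan_inside_outside[OF q(1,2)]
  have disj: "open_edge e \<inter> drawn S = {}" using open_edge_disjoint eH SH by blast
  obtain m where m: "m \<in> open_edge e" using open_edge_nonempty[OF eH(1)] by blast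
  then have mS: "m \<in> - drawn S" and mC: "m \<in> ?C" using disj open_edge_subset q by blast+
  obtain r where r: "r > 0" "ball m r \<subseteq> - drawn S"
    using open_Compl_drawn[OF SH] mS by (meson openE)
  define f0 where "f0 = connected_component_set (- drawn S) m"
  have f0: "f0 \<in> components (- drawn S)" using mS by (auto simp: f0_def components_def)
  have mf0: "m \<in> f0" using mS by (simp add: f0_def)
  have ball_f0: "ball m r \<subseteq> f0"
    using r by (auto simp: f0_def intro: connected_component_ballI)
  have e_f0: "open_edge e \<subseteq> f0"
    unfolding f0_def by (rule connected_component_maximal[OF m connected_open_edge[OF eH(1)]])
      (use disj in blast)
  have U: "?U = - drawn S - path_image (\<gamma> e)" by (auto simp: drawn_insert)
  \<comment> \<open>Every point of a Jordan curve is on the frontier of both sides, so the disc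
    around \<open>m\<close> contains points of both.\<close>
  have "m \<in> closure (inside ?C)" "m \<in> closure (outside ?C)"
    using J mC by (metis DiffD1 frontier_def)+
  then obtain z1 z2 where z: "z1 \<in> inside ?C" "z1 \<in> ball m r" "z2 \<in> outside ?C" "z2 \<in> ball m r"
    using r(1) by (metis closure_approachable dist_commute mem_ball)
  have zU: "z1 \<in> ?U" "z2 \<in> ?U"
  proof -
    have "z1 \<in> - ?C" "z2 \<in> - ?C" using z J by blast+
    moreover have "z1 \<in> - drawn S" "z2 \<in> - drawn S" using z r by blast+
    ultimately show "z1 \<in> ?U" "z2 \<in> ?U" using q(3) U by blast+
  qed
  define g1 where "g1 = connected_component_set ?U z1"
  define g2 where "g2 = connected_component_set ?U z2"
  have g: "g1 \<in> components ?U" "g2 \<in> components ?U" "z1 \<in> g1" "z2 \<in> g2"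
    using zU by (auto simp: g1_def g2_def components_def)
  have U_C: "?U \<subseteq> - ?C" using q PS by (auto simp: drawn_insert)
  have "g1 \<noteq> g2"
  proof
    assume "g1 = g2"
    then have con: "connected g1" "z1 \<in> g1" "z2 \<in> g1"
      using g in_components_connected by auto
    have "g1 \<subseteq> inside ?C \<union> outside ?C" using in_components_subset[OF g(1)] U_C J by blast
    then show False
      using connectedD[OF con(1), of "inside ?C" "outside ?C"] J z con by blast
  qed
  have sub: "g \<subseteq> f0" if "g \<in> components ?U" "g \<inter> ball m r \<noteq> {}" for g
  proof (rule components_maximal[OF f0])
    show "connected g" using that in_components_connected by blast
    show "g \<subseteq> - drawn S" using in_components_subset[OF that(1)] U by blast
    show "f0 \<inter> g \<noteq> {}" using that ball_f0 by blast
  qed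
  have g_f0: "g1 \<subseteq> f0" "g2 \<subseteq> f0" using sub g z by blast+
  \<comment> \<open>If \<open>f0\<close> belongs to \<open>X\<close>, it is replaced by two faces;
    otherwise two faces are gained. The count rises by at least one in both cases.\<close>
  define Y where "Y = (X - {f0}) \<union> {g1, g2}"
  have other: "f \<in> components ?U \<and> f \<inter> f0 = {}" if f: "f \<in> X - {f0}" for f
  proof -
    have fc: "f \<in> components (- drawn S)" using f X by blast
    have dis: "f \<inter> f0 = {}" using f fc f0 components_nonoverlap by blast
    have fS: "f \<subseteq> - drawn S" using in_components_subset[OF fc] .
    \<comment> \<open>The ends of \<open>e\<close> lie on \<open>P\<close>, hence already on the old
      drawing; the rest of \<open>e\<close> lies in \<open>f0\<close>. So a face other than
      \<open>f0\<close> does not meet the arc of \<open>e\<close>.\<close>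
    have "path_image (\<gamma> e) \<subseteq> open_edge e \<union> drawn S" using q PS by (auto simp: open_edge_def)
    then have "f \<subseteq> ?U" using fS dis e_f0 U by blast
    then show ?thesis using components_intermediate_subset[OF fc, of ?U] U dis by blast
  qed
  have "Y \<subseteq> components ?U" using other g by (auto simp: Y_def)
  moreover have "finite Y" using X by (simp add: Y_def)
  moreover have "Suc (card X) \<le> card Y"
  proof -
    have "g1 \<notin> X - {f0}" "g2 \<notin> X - {f0}" using other g g_f0 by blast+
    then have "card Y = card (X - {f0}) + 2"
      unfolding Y_def using X \<open>g1 \<noteq> g2\<close> by (subst card_Un_disjoint) auto
    moreover have "card X \<le> Suc (card (X - {f0}))" using X card_Suc_Diff1[of X f0] by (cases "f0 \<in> X") auto
    ultimately show ?thesis by simp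
  qed
  ultimately show ?thesis by blast
qed

text \<open>The forest \<open>T\<close> leaves a single face and each edge of \<open>R\<close> adds
  one. The cycle it closes uses only \<open>T\<close> besides itself, so the edges of
  \<open>R\<close> may be inserted in any order.\<close>

lemma faces_lower_bound:
  assumes TH: "T \<subseteq> edges H" and T: "acyclic_edges T"
    and RH: "R \<subseteq> edges H - T" and R: "\<forall>e\<in>R. \<not> acyclic_edges (insert e T)"
  shows "\<exists>X. X \<subseteq> components (- drawn (T \<union> R)) \<and> finite X \<and> Suc (card R) \<le> card X"
proof -
  have "finite R" using RH finite_edges finite_subset by blast
  then show ?thesis using RH R
  proof (induction R)
    case empty
    have "bounded (drawn T)" using compact_drawn[OF TH] compact_imp_bounded by blast
    then have "- drawn T \<noteq> {}" by (metis Compl_empty_eq double_complement not_bounded_UNIV)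
    then have "components (- drawn T) = {- drawn T}"
      using connected_Compl_drawn_acyclic[OF TH T] by (simp add: components_eq_sing_iff)
    then show ?case by (intro exI[of _ "{- drawn T}"]) simp
  next
    case (insert e R)
    then obtain X where X: "X \<subseteq> components (- drawn (T \<union> R))" "finite X" "Suc (card R) \<le> card X"
      by auto
    obtain c where c: "cycle_in (insert e T) c" using insert.prems by (auto simp: acyclic_edges_def)
    have "e \<in> cycle_edges c"
    proof (rule ccontr)
      assume "e \<notin> cycle_edges c"
      then have "cycle_in T c" using c by (auto simp: cycle_in_iff)
      then show False using T by (auto simp: acyclic_edges_def)
    qed
    moreover have "cycle_in (insert e (T \<union> R)) c" using c by (auto simp: cycle_in_iff)
    ultimately obtain Y where "Y \<subseteq> components (- drawn (insert e (T \<union> R)))" "finite Y" "Suc (card X) \<le> card Y"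
      using new_face[of "T \<union> R" e c X] X TH insert.prems insert.hyps by blast
    then show ?case using X insert by (intro exI[of _ Y]) auto
  qed
qed

lemma card_touching_faces_le_2:
  assumes SH: "S \<subseteq> edges H" and cyc: "cycle_in S c" "e \<in> cycle_edges c"
    and X: "X \<subseteq> components (- drawn S)" "finite X"
  shows "card {f \<in> X. touches f e} \<le> 2"
proof -
  obtain q P where q: "simple_path q" "pathfinish q = pathstart q"
    "path_image q = path_image (\<gamma> e) \<union> P" "connected P" "P \<subseteq> drawn (S - {e})" "p ` e \<subseteq> P"
    by (rule cycle_curve[OF SH cyc])
  let ?C = "path_image q" and ?A = "drawn (S - {e})"
  note J = Jordan_inside_outside[OF q(1,2)]
  have eS: "e \<in> S" using cyc by (auto simp: cycle_in_iff)
  have eH: "e \<in> edges H" using eS SH by blast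
  have AH: "S - {e} \<subseteq> edges H" using SH by blast
  have AC: "?A \<union> ?C = drawn S"
    using q(3,5) eS drawn_insert[of e "S - {e}"] by (auto simp: insert_absorb)
  have disj: "open_edge e \<inter> ?A = {}" using open_edge_disjoint[OF eH AH] by blast
  \<comment> \<open>The intersection is the arc opposite to \<open>e\<close>, hence connected, which
    Janiszewski's theorem requires below.\<close>
  have AIC: "?A \<inter> ?C = P" using q(3,5,6) disj by (auto simp: open_edge_def)
  \<comment> \<open>A disc around a frontier point on the open edge misses all other edges and
    contains a point of \<open>f\<close>; so \<open>f\<close> can be linked to \<open>e\<close>
    without meeting \<open>?A\<close>.\<close>
  have near: "\<exists>z m. z \<in> f \<and> m \<in> open_edge e \<and> connected_component (- ?A) m z"
    if t: "touches f e" for f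
  proof -
    obtain m where m: "m \<in> open_edge e" "m \<in> closure f"
      using t by (auto simp: touches_def frontier_def)
    then have "m \<in> - ?A" using disj by blast
    then obtain r where r: "r > 0" "ball m r \<subseteq> - ?A"
      using open_Compl_drawn[OF AH] by (meson openE)
    obtain z where "z \<in> f" "z \<in> ball m r"
      using m r(1) by (metis closure_approachable dist_commute mem_ball)
    then show ?thesis using connected_component_ballI[OF r(2)] m by blast
  qed
  \<comment> \<open>Points of the two faces are joined off \<open>?A\<close> along the open edge,
    and off the curve within \<open>W\<close>. By Janiszewski's theorem they are joined off the
    union, which is the whole drawing. \<open>W\<close> will be the inside or the outside of the
    curve.\<close>
  have same: "f = g"
    if fg: "f \<in> components (- drawn S)" "g \<in> components (- drawn S)" "touches f e" "touches g e"
      and W: "connected W" "W \<subseteq> - ?C" "f \<subseteq> W" "g \<subseteq> W" for f g W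
  proof -
    obtain z m where z: "z \<in> f" "m \<in> open_edge e" "connected_component (- ?A) m z"
      using near[OF fg(3)] by blast
    obtain z' m' where z': "z' \<in> g" "m' \<in> open_edge e" "connected_component (- ?A) m' z'"
      using near[OF fg(4)] by blast
    have "connected_component (- ?A) m m'"
      unfolding connected_component_def
      using z z' disj connected_open_edge[OF eH] by blast
    then have 1: "connected_component (- ?A) z z'"
      using z z' by (meson connected_component_sym connected_component_trans)
    have 2: "connected_component (- ?C) z z'"
      unfolding connected_component_def using W z z' by blast
    have "connected_component (- (?A \<union> ?C)) z z'"
    proof (rule Janiszewski[OF _ _ _ 1 2])
      show "compact ?A" using compact_drawn[OF AH] .
      show "closed ?C" using q(1) by (simp add: closed_path_image simple_path_imp_path)
      show "connected (?A \<inter> ?C)" using AIC q by simp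
    qed
    then have con: "connected_component (- drawn S) z z'" using AC by simp
    obtain t where t: "connected t" "t \<subseteq> - drawn S" "z \<in> t" "z' \<in> t"
      using con by (auto simp: connected_component_def)
    have "t \<subseteq> f" using components_maximal[OF fg(1) t(1,2)] t(3) z(1) by blast
    then show ?thesis using components_eq[OF fg(1,2)] t(4) z'(1) by blast
  qed
  have side: "f \<subseteq> inside ?C \<or> f \<subseteq> outside ?C" if f: "f \<in> X" for f
  proof -
    have fc: "f \<in> components (- drawn S)" using f X by blast
    have "f \<subseteq> inside ?C \<union> outside ?C" using in_components_subset[OF fc] AC J by blast
    then show ?thesis
      using connectedD[OF in_components_connected[OF fc], of "inside ?C" "outside ?C"] J by blast
  qed
  have sing: "card {f \<in> X. touches f e \<and> f \<subseteq> W} \<le> 1" if "connected W" "W \<subseteq> - ?C" for W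
  proof -
    have "f = g" if "f \<in> {f \<in> X. touches f e \<and> f \<subseteq> W}" "g \<in> {f \<in> X. touches f e \<and> f \<subseteq> W}" for f g
      by (rule same[OF _ _ _ _ \<open>connected W\<close> \<open>W \<subseteq> - ?C\<close>]) (use that X in auto)
    then show ?thesis using X(2) by (simp add: card_le_Suc0_iff_eq)
  qed
  have "{f \<in> X. touches f e} \<subseteq>
      {f \<in> X. touches f e \<and> f \<subseteq> inside ?C} \<union> {f \<in> X. touches f e \<and> f \<subseteq> outside ?C}"
    (is "_ \<subseteq> ?I \<union> ?O")
    using side by blast
  then have "card {f \<in> X. touches f e} \<le> card (?I \<union> ?O)"
    using X by (intro card_mono) auto
  moreover have "card (?I \<union> ?O) \<le> card ?I + card ?O" by (rule card_Un_le)
  moreover have "card ?I \<le> 1" using J by (intro sing) blast+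
  moreover have "card ?O \<le> 1" using J by (intro sing) blast+
  ultimately show ?thesis by linarith
qed

text \<open>If the touched edges formed a forest, then they and finitely many points would not
  separate the plane. As these contain the frontier of \<open>f\<close>, the face would be their
  whole complement, leaving no room for other edges, and \<open>S\<close> itself would be a
  forest.\<close>

lemma touched_edges_not_acyclic:
  assumes SH: "S \<subseteq> edges H" and f: "f \<in> components (- drawn S)" and S: "\<not> acyclic_edges S"
  shows "\<not> acyclic_edges {e \<in> S. touches f e}"
proof
  let ?S = "{e \<in> S. touches f e}"
  \<comment> \<open>The vertex points are included since \<open>touches\<close> looks at open edges
    only: a frontier point of \<open>f\<close> may be an end of an edge that \<open>f\<close> does
    not touch.\<close>
  define D where "D = drawn ?S \<union> p ` (\<Union>S)"
  assume acyc: "acyclic_edges ?S"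
  have SfH: "?S \<subseteq> edges H" using SH by blast
  have "finite (\<Union>S)" using finite_verts edge_subset SH by (meson Sup_le_iff finite_subset subsetD)
  then have con: "connected (- D)"
    using connected_Compl_drawn_Un_finite[OF SfH acyc] by (simp only: D_def) blast
  have ends: "p ` e \<subseteq> path_image (\<gamma> e)" if "e \<in> edges H" for e
    using edge_ends[OF that] pathstart_in_path_image[of "\<gamma> e"] pathfinish_in_path_image[of "\<gamma> e"]
    by (metis empty_subsetI insert_subset)
  have "p ` (\<Union>S) \<subseteq> drawn S" using ends SH by (fastforce simp: drawn_def)
  then have DS: "D \<subseteq> drawn S" using drawn_mono[of ?S S] by (auto simp: D_def)
  have "frontier f \<subseteq> drawn S"
    using frontier_of_components_closed_complement[OF compact_imp_closed[OF compact_drawn[OF SH]] f] .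
  then have fr: "frontier f \<subseteq> D"
    by (fastforce simp: D_def drawn_def touches_def open_edge_def)
  have fS: "f \<subseteq> - drawn S" using in_components_subset[OF f] .
  have fD: "f = - D"
  proof (rule ccontr)
    assume "f \<noteq> - D"
    moreover have "f \<subseteq> - D" using fS DS by (meson Compl_anti_mono order_trans)
    ultimately have "- D - f \<noteq> {}" "- D \<inter> f \<noteq> {}"
      using in_components_nonempty[OF f] by (auto simp only:)
    then have "- D \<inter> frontier f \<noteq> {}" by (intro connected_Int_frontier[OF con])
    then show False using fr by blast
  qed
  \<comment> \<open>An interior point of an edge of \<open>S\<close> lies outside \<open>f\<close>,
    hence in \<open>D\<close>. Not being a vertex point, it lies on a touched edge, which can only
    be that edge itself.\<close>
  have "S \<subseteq> ?S"
  proof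
    fix e assume e: "e \<in> S"
    then have eH: "e \<in> edges H" using SH by blast
    obtain m where m: "m \<in> open_edge e" using open_edge_nonempty[OF eH] by blast
    have "m \<in> drawn S" using m e open_edge_subset by (auto simp: drawn_def)
    then have "m \<in> D" using fS fD by blast
    moreover have "m \<notin> p ` (\<Union>S)"
    proof
      assume "m \<in> p ` (\<Union>S)"
      then have "m \<in> path_image (\<gamma> e) \<inter> p ` verts H"
        using m open_edge_subset edge_subset SH by blast
      moreover have "path_image (\<gamma> e) \<inter> p ` verts H = p ` e"
        using drawing eH by (simp add: plane_drawing_def)
      ultimately have "m \<in> p ` e" by blast
      then show False using m by (simp add: open_edge_def)
    qed
    ultimately have "m \<in> drawn ?S" by (simp add: D_def)
    then have "open_edge e \<inter> drawn ?S \<noteq> {}" using m by blast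
    then show "e \<in> ?S" using open_edge_disjoint[OF eH SfH] by argo
  qed
  then show False using acyclic_edges_subset[OF acyc, of S] S by argo
qed

text \<open>Double counting of touching pairs: the edges touched by a face contain a cycle, so there
  are at least \<open>k\<close> of them, while an edge lying on a cycle touches at most two
  faces.\<close>

lemma faces_upper_bound:
  assumes SH: "S \<subseteq> edges H" and cyc: "\<forall>e\<in>S. \<exists>c. cycle_in S c \<and> e \<in> cycle_edges c"
    and "S \<noteq> {}" and long: "\<forall>c. cycle_in S c \<longrightarrow> k \<le> length c"
    and X: "X \<subseteq> components (- drawn S)" "finite X"
  shows "k * card X \<le> 2 * card S"
proof -
  have finS: "finite S" using SH finite_edges finite_subset by blast
  have nac: "\<not> acyclic_edges S" using cyc \<open>S \<noteq> {}\<close> by (auto simp: acyclic_edges_def)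
  have deg: "k \<le> card {e \<in> S. touches f e}" if "f \<in> X" for f
  proof -
    have "f \<in> components (- drawn S)" using X that by blast
    from touched_edges_not_acyclic[OF SH this nac]
    obtain c where c: "cycle_in {e \<in> S. touches f e} c" by (auto simp: acyclic_edges_def)
    then have "cycle_in S c" by (auto simp: cycle_in_iff)
    then have "k \<le> card (cycle_edges c)" using long c by (simp add: cycle_in_iff card_cycle_edges)
    also have "\<dots> \<le> card {e \<in> S. touches f e}"
      using c finS by (intro card_mono) (auto simp: cycle_in_iff)
    finally show ?thesis .
  qed
  have "k * card X = (\<Sum>f\<in>X. k)" by simp
  also have "\<dots> \<le> (\<Sum>f\<in>X. card {e \<in> S. touches f e})" by (intro sum_mono deg)
  also have "\<dots> = (\<Sum>f\<in>X. \<Sum>e | e \<in> S \<and> touches f e. 1)" by simp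
  also have "\<dots> = (\<Sum>e\<in>S. \<Sum>f | f \<in> X \<and> touches f e. 1)"
    by (rule sum.swap_restrict[OF X(2) finS])
  also have "\<dots> = (\<Sum>e\<in>S. card {f \<in> X. touches f e})" by simp
  also have "\<dots> \<le> (\<Sum>e\<in>S. 2)"
    using card_touching_faces_le_2[OF SH _ _ X] cyc by (intro sum_mono) blast
  finally show ?thesis by simp
qed

section \<open>The Euler count with the bridges set aside\<close>

theorem card_edges_triangle_free:
  assumes long: "\<forall>c. cycle_in (edges H) c \<longrightarrow> 4 \<le> length c" and V: "3 \<le> card (verts H)"
  shows "card (edges H) + 4 \<le> 2 * card (verts H)"
proof -
  let ?E = "edges H"
  \<comment> \<open>The bridges, seen as edges on no cycle. Without them all cycles remain and every
    edge lies on one, as the bound of two faces per edge requires.\<close>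
  define B where "B = {e \<in> ?E. \<nexists>c. cycle_in ?E c \<and> e \<in> cycle_edges c}"
  obtain T where T: "T \<subseteq> ?E" "acyclic_edges T" "\<forall>e\<in>?E - T. \<not> acyclic_edges (insert e T)"
    by (rule maximal_acyclic_subset[OF finite_edges])
  have closes: "\<exists>c. cycle_in (insert e T) c \<and> e \<in> cycle_edges c" if "e \<in> ?E - T" for e
  proof -
    from T(3) that obtain c where "cycle_in (insert e T) c" by (auto simp: acyclic_edges_def)
    then show ?thesis using T(2) by (fastforce simp: acyclic_edges_def cycle_in_iff)
  qed
  have noB: "cycle_edges c \<inter> B = {}" if "cycle_in ?E c" for c
    using that by (auto simp: B_def)
  have inE: "cycle_in ?E c" if "cycle_in (insert e T) c" "e \<in> ?E" for c e
    using that T(1) by (auto simp: cycle_in_iff)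
  have BT: "B \<subseteq> T"
  proof
    fix e assume "e \<in> B"
    then show "e \<in> T" using closes[of e] inE unfolding B_def by blast
  qed
  define S where "S = ?E - B"
  define T' where "T' = T - B"
  define R where "R = ?E - T"
  have SH: "S \<subseteq> ?E" by (auto simp: S_def)
  have S_eq: "S = T' \<union> R" using BT T by (auto simp: S_def T'_def R_def)
  have fin: "finite ?E" "finite B" "finite T" "finite R" "finite T'"
    using finite_edges T by (auto simp: B_def R_def T'_def intro: finite_subset)
  have "verts H \<noteq> {}" using V by auto
  then have cT: "card T < card (verts H)"
    using acyclic_edges_card_less[OF finite_verts _ _ T(2)] T(1) edge_subset edge_card by blast
  have cT': "card T = card T' + card B" using BT fin by (simp add: T'_def card_Diff_subset card_mono)
  have cE: "card ?E = card S + card B" using fin by (simp add: S_def B_def card_Diff_subset card_mono)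
  have cS: "card S = card T' + card R"
    unfolding S_eq using fin by (intro card_Un_disjoint) (auto simp: T'_def R_def)
  show ?thesis
  proof (cases "S = {}")
    case True
    \<comment> \<open>All edges are bridges, so there are at most \<open>card (verts H) - 1\<close>
      of them, and three vertices suffice for the claim.\<close>
    then show ?thesis using cE cT cT' cS V by simp
  next
    case False
    have "\<exists>X. X \<subseteq> components (- drawn (T' \<union> R)) \<and> finite X \<and> Suc (card R) \<le> card X"
    proof (rule faces_lower_bound)
      show "T' \<subseteq> ?E" using T by (auto simp: T'_def)
      show "acyclic_edges T'" using acyclic_edges_subset[OF T(2)] by (auto simp: T'_def)
      show "R \<subseteq> ?E - T'" by (auto simp: R_def T'_def)
      show "\<forall>e\<in>R. \<not> acyclic_edges (insert e T')"
      proof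
        fix e assume e: "e \<in> R"
        \<comment> \<open>The cycle that \<open>e\<close> closes with \<open>T\<close> contains no
          bridge, so it survives in \<open>T'\<close>.\<close>
        then obtain c where c: "cycle_in (insert e T) c" using closes by (auto simp: R_def)
        then have "cycle_in (insert e T') c"
          using noB[of c] inE[OF c] e unfolding cycle_in_iff T'_def R_def by blast
        then show "\<not> acyclic_edges (insert e T')" by (auto simp: acyclic_edges_def)
      qed
    qed
    then obtain X where X: "X \<subseteq> components (- drawn S)" "finite X" "Suc (card R) \<le> card X"
      unfolding S_eq by blast
    have "4 * card X \<le> 2 * card S"
    proof (rule faces_upper_bound[OF SH _ False _ X(1,2)])
      show "\<forall>e\<in>S. \<exists>c. cycle_in S c \<and> e \<in> cycle_edges c"
      proof
        fix e assume "e \<in> S"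
        then obtain c where c: "cycle_in ?E c" "e \<in> cycle_edges c" by (auto simp: S_def B_def)
        then have "cycle_in S c" using noB[of c] by (auto simp: cycle_in_iff S_def)
        then show "\<exists>c. cycle_in S c \<and> e \<in> cycle_edges c" using c by blast
      qed
      show "\<forall>c. cycle_in S c \<longrightarrow> 4 \<le> length c" using long SH by (auto simp: cycle_in_iff)
    qed
    \<comment> \<open>From \<open>4 * (card R + 1) \<le> 2 * (card T' + card R)\<close> follows
      \<open>card R + 2 \<le> card T'\<close>. Hence \<open>card T' + card R + card B\<close> is at
      most \<open>2 * card T - 2\<close>, and \<open>card T\<close> is at most
      \<open>card (verts H) - 1\<close>.\<close>
    then show ?thesis using X cE cT cT' cS by linarith
  qed
qed

end

section \<open>Straight-line drawings\<close>

text \<open>The family \<open>K\<close> is meant to contain the singletons of the vertices besides the edges: then the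
  condition also says that vertices are distinct points lying on no other edge.\<close>

definition straight :: "('a \<Rightarrow> complex) \<Rightarrow> 'a set set \<Rightarrow> bool" where
  "straight p K \<longleftrightarrow> (\<forall>k\<in>K. \<forall>l\<in>K. k \<noteq> l \<longrightarrow>
     convex hull (p ` k) \<inter> convex hull (p ` l) \<subseteq> p ` (k \<inter> l))"

lemma straightD:
  "straight p K \<Longrightarrow> k \<in> K \<Longrightarrow> l \<in> K \<Longrightarrow> k \<noteq> l \<Longrightarrow>
     z \<in> convex hull (p ` k) \<Longrightarrow> z \<in> convex hull (p ` l) \<Longrightarrow> z \<in> p ` (k \<inter> l)"
  unfolding straight_def by blast

lemma straight_subset: "straight p K \<Longrightarrow> L \<subseteq> K \<Longrightarrow> straight p L"
  unfolding straight_def by blast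

lemma straight_image:
  assumes "straight p K" "inj F" "\<And>A. convex hull (F ` A) = F ` (convex hull A)"
  shows "straight (F \<circ> p) K"
  unfolding straight_def
proof (intro ballI impI)
  fix k l assume kl: "k \<in> K" "l \<in> K" "k \<noteq> l"
  have "convex hull ((F \<circ> p) ` k) \<inter> convex hull ((F \<circ> p) ` l)
      = F ` (convex hull (p ` k) \<inter> convex hull (p ` l))"
    by (simp only: image_comp[symmetric] assms(3) image_Int[OF assms(2)])
  also have "\<dots> \<subseteq> F ` p ` (k \<inter> l)" 
    using assms(1) kl unfolding straight_def by (intro image_mono) blast
  finally show "convex hull ((F \<circ> p) ` k) \<inter> convex hull ((F \<circ> p) ` l) \<subseteq> (F \<circ> p) ` (k \<inter> l)"
    by (simp add: image_comp)
qed

lemma straight_Un: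
  assumes "straight p K"
    and "\<And>k l. k \<in> K \<Longrightarrow> l \<in> L \<Longrightarrow> convex hull (p ` k) \<inter> convex hull (p ` l) \<subseteq> p ` (k \<inter> l)"
    and "straight p L"
  shows "straight p (K \<union> L)"
  unfolding straight_def
proof (intro ballI impI)
  fix k l assume "k \<in> K \<union> L" "l \<in> K \<union> L" "k \<noteq> l"
  then consider "k \<in> K" "l \<in> K" | "k \<in> K" "l \<in> L" | "k \<in> L" "l \<in> K" | "k \<in> L" "l \<in> L" by blast
  then show "convex hull (p ` k) \<inter> convex hull (p ` l) \<subseteq> p ` (k \<inter> l)"
  proof cases
    case 3
    then show ?thesis using assms(2)[of l k] by (simp add: Int_commute)
  qed (use assms \<open>k \<noteq> l\<close> in \<open>auto simp: straight_def\<close>)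
qed

lemma straight_cong:
  assumes "straight p K" "\<And>x. x \<in> \<Union>K \<Longrightarrow> p' x = p x"
  shows "straight p' K"
proof -
  have im: "p' ` A = p ` A" if "A \<subseteq> \<Union>K" for A
    by (rule image_cong[OF refl assms(2)]) (use that in blast)
  have "p' ` k = p ` k" "p' ` (k \<inter> l) = p ` (k \<inter> l)" if "k \<in> K" for k l
    by (rule im, use that in blast)+
  then show ?thesis using assms(1) by (simp add: straight_def)
qed

text \<open>Meant for the copies of an isolated vertex: what is drawn already lies in a disc of
  radius \<open>R\<close>, and the new pair is put on the real axis beyond it.\<close>

lemma straight_add_far_pair:
  assumes "straight p K" "finite K" "\<forall>k\<in>K. finite k" "c \<noteq> d" "c \<notin> \<Union>K" "d \<notin> \<Union>K"
  shows "\<exists>p'. straight p' (K \<union> {{c}, {d}, {c, d}})"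
proof -
  have "bounded (\<Union>k\<in>K. convex hull (p ` k))"
    using assms(2,3) by (intro bounded_UN) (auto intro: bounded_convex_hull finite_imp_bounded)
  then obtain R where R: "\<And>k z. k \<in> K \<Longrightarrow> z \<in> convex hull (p ` k) \<Longrightarrow> norm z \<le> R"
    by (auto simp: bounded_iff)
  define p' where "p' = p(c := complex_of_real (R + 1), d := complex_of_real (R + 2))"
  have old: "p' x = p x" if "x \<in> \<Union>K" for x using that assms by (auto simp: p'_def)
  have old_im: "p' ` k = p ` k" if "k \<in> K" for k using old that by (intro image_cong) auto
  have cd: "p' c = complex_of_real (R + 1)" "p' d = complex_of_real (R + 2)"
    using assms by (auto simp: p'_def)
  have seg: "R + 1 \<le> Re z" if "z \<in> convex hull {complex_of_real (R + 1), complex_of_real (R + 2)}" for z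
    using that hull_minimal[of "{complex_of_real (R + 1), complex_of_real (R + 2)}"
        "{z. Re z \<ge> R + 1}" convex] convex_halfspace_Re_ge[of "R + 1"] by auto
  have "straight p' (K \<union> {{c}, {d}, {c, d}})"
  proof (rule straight_Un)
    show "straight p' K" by (rule straight_cong[OF assms(1)]) (use old in auto)
    show "straight p' {{c}, {d}, {c, d}}"
      using assms(4) by (auto simp: straight_def cd complex_eq_iff)
    fix k l assume kl: "k \<in> K" "l \<in> {{c}, {d}, {c, d}}"
    have "R + 1 \<le> Re z" if "z \<in> convex hull (p' ` l)" for z
    proof -
      have "p' ` l \<subseteq> {complex_of_real (R + 1), complex_of_real (R + 2)}" using kl cd by auto
      then show ?thesis using that hull_mono seg by blast
    qed
    moreover have "norm z \<le> R" if "z \<in> convex hull (p' ` k)" for z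
      using that R[OF kl(1)] old_im[OF kl(1)] by simp
    moreover have "Re z \<le> norm z" for z by (rule complex_Re_le_cmod)
    ultimately show "convex hull (p' ` k) \<inter> convex hull (p' ` l) \<subseteq> p' ` (k \<inter> l)"
      by (smt (verit) Int_iff subsetI)
  qed
  then show ?thesis by blast
qed

text \<open>Stretching the imaginary axis by \<open>M\<close> turns the thin triangle
  \<open>0 \<le> Im z \<and> M * Im z \<le> 2 * (1 - \<bar>Re z\<bar>)\<close> over the segment from \<open>-1\<close> to \<open>1\<close> into the triangle with
  apex \<open>2 * \<i>\<close>, so that the positions \<open>2 * \<i>\<close> and \<open>\<i>\<close> of the new vertices need not depend on \<open>M\<close>.\<close>

lemma thin_avoids_disjoint:
  fixes S :: "complex set"
  assumes "compact S" "S \<inter> closed_segment (-1) 1 = {}"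
  shows "\<forall>\<^sub>F M in at_top. \<forall>z\<in>S. \<not> (0 \<le> Im z \<and> M * Im z \<le> 2 * (1 - \<bar>Re z\<bar>))"
proof -
  obtain \<delta> where \<delta>: "\<delta> > 0" "\<And>x y. x \<in> S \<Longrightarrow> y \<in> closed_segment (-1) 1 \<Longrightarrow> \<delta> \<le> dist x y"
    using separate_compact_closed[OF assms(1) closed_segment assms(2)] by blast
  \<comment> \<open>A point of the thin triangle lies at height at most \<open>2 / M\<close> above
    its foot \<open>Re z\<close> on the segment, which is closer than
    \<open>\<delta>\<close>.\<close>
  have "\<not> (0 \<le> Im z \<and> M * Im z \<le> 2 * (1 - \<bar>Re z\<bar>))" if M: "M > 2 / \<delta>" and z: "z \<in> S" for M z
  proof
    assume A: "0 \<le> Im z \<and> M * Im z \<le> 2 * (1 - \<bar>Re z\<bar>)"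
    have M0: "M > 0" using M \<delta> by (meson divide_pos_pos less_trans zero_less_numeral)
    then have "0 \<le> M * Im z" using A by simp
    then have re: "\<bar>Re z\<bar> \<le> 1" using order_trans[OF _ conjunct2[OF A]] by fastforce
    then have "complex_of_real (Re z) \<in> closed_segment (-1) 1"
      unfolding in_segment
      by (intro exI[of _ "(1 + Re z) / 2"]) (auto simp: complex_eq_iff algebra_simps)
    then have "\<delta> \<le> dist z (complex_of_real (Re z))" using \<delta>(2) z by blast
    also have "\<dots> = Im z" using A by (simp add: dist_norm cmod_def)
    finally have "M * \<delta> \<le> M * Im z" using M0 by simp
    also have "\<dots> \<le> 2 * (1 - \<bar>Re z\<bar>)" using A by blast
    also have "\<dots> \<le> 2" by simp
    finally show False using M \<delta> by (simp add: field_simps)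
  qed
  then have "\<forall>z\<in>S. \<not> (0 \<le> Im z \<and> M * Im z \<le> 2 * (1 - \<bar>Re z\<bar>))" if "M > 2 / \<delta>" for M
    using that by blast
  then show ?thesis by (rule eventually_mono[OF eventually_gt_at_top])
qed

text \<open>If \<open>Im y > 0\<close>, the segment leaves the corner -1 in a fixed upward
  direction, which lies above the left side of slope \<open>2 / M\<close> once \<open>M\<close> is
  large. Otherwise a common point other than the corner would lie on the base, against the
  assumption.\<close>

lemma thin_avoids_left:
  assumes "closed_segment (-1) y \<inter> closed_segment (-1) 1 \<subseteq> {-1 :: complex}"
  shows "\<forall>\<^sub>F M in at_top. \<forall>z\<in>closed_segment (-1) y.
           0 \<le> Im z \<and> M * Im z \<le> 2 * (1 - \<bar>Re z\<bar>) \<longrightarrow> z = -1"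
proof -
  have main: "z = -1" if z: "z \<in> closed_segment (-1) y"
    and A: "0 \<le> Im z" "M * Im z \<le> 2 * (1 - \<bar>Re z\<bar>)"
    and M: "M > 0" "Im y > 0 \<Longrightarrow> M * Im y > 2 * (Re y + 1)" for z M
  proof -
    obtain u where u: "0 \<le> u" "u \<le> 1" "z = (1 - u) *\<^sub>R (-1) + u *\<^sub>R y"
      using z by (auto simp: in_segment)
    have im: "Im z = u * Im y" and re: "Re z = u * (Re y + 1) - 1"
      unfolding u(3) by (simp_all add: algebra_simps)
    show ?thesis
    proof (cases "u = 0")
      case True
      then show ?thesis using u by simp
    next
      case False
      then have u0: "u > 0" using u by simp
      show ?thesis
      proof (cases "Im y > 0")
        case True
        have "2 * (1 - \<bar>Re z\<bar>) \<le> 2 * (1 + Re z)" by simp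
        then have "M * Im z \<le> 2 * (1 + Re z)" using A by (rule_tac order_trans)
        then have "u * (M * Im y) \<le> u * (2 * (Re y + 1))" by (simp add: im re algebra_simps)
        then show ?thesis using M(2)[OF True] u0 by simp
      next
        case False
        then have "Im z = 0" using A(1) u0 by (simp add: im zero_le_mult_iff)
        then have "\<bar>Re z\<bar> \<le> 1" using A(2) by simp
        with \<open>Im z = 0\<close> have "z \<in> closed_segment (-1) 1"
          unfolding in_segment
          by (intro exI[of _ "(1 + Re z) / 2"]) (auto simp: complex_eq_iff algebra_simps)
        then show ?thesis using assms z by blast
      qed
    qed
  qed
  have "\<forall>\<^sub>F M in at_top. M > 0 \<and> M > 2 * (Re y + 1) / Im y"
    by (intro eventually_conj eventually_gt_at_top)
  then show ?thesis
    by (rule eventually_mono) (auto intro!: main simp: field_simps)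
qed

text \<open>The reflection \<open>\<lambda>z. - cnj z\<close> exchanges the corners -1 and 1 and
  preserves the triangle, so the left case applies.\<close>

lemma thin_avoids_right:
  assumes "closed_segment 1 y \<inter> closed_segment (-1) 1 \<subseteq> {1 :: complex}"
  shows "\<forall>\<^sub>F M in at_top. \<forall>z\<in>closed_segment 1 y.
           0 \<le> Im z \<and> M * Im z \<le> 2 * (1 - \<bar>Re z\<bar>) \<longrightarrow> z = 1"
proof -
  have refl: "- cnj z \<in> closed_segment (- cnj a) (- cnj b) \<longleftrightarrow> z \<in> closed_segment a b" for z a b
    by (auto simp: in_segment complex_eq_iff)
  have "closed_segment (-1) (- cnj y) \<inter> closed_segment (-1) 1 \<subseteq> {-1 :: complex}"
  proof
    fix z assume z: "z \<in> closed_segment (-1) (- cnj y) \<inter> closed_segment (-1) 1"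
    have "- cnj z \<in> closed_segment 1 y" "- cnj z \<in> closed_segment (-1) 1"
      using z refl[of z "-1" "- cnj y"] refl[of z "-1" 1] by (auto simp: closed_segment_commute)
    then have "- cnj z = 1" using assms by blast
    then show "z \<in> {-1}" by (simp add: complex_eq_iff)
  qed
  from thin_avoids_left[OF this] show ?thesis
  proof (rule eventually_mono, intro ballI impI)
    fix M z
    assume *: "\<forall>z\<in>closed_segment (-1) (- cnj y).
           0 \<le> Im z \<and> M * Im z \<le> 2 * (1 - \<bar>Re z\<bar>) \<longrightarrow> z = -1"
      and z: "z \<in> closed_segment 1 y" "0 \<le> Im z \<and> M * Im z \<le> 2 * (1 - \<bar>Re z\<bar>)"
    have "- cnj z \<in> closed_segment (-1) (- cnj y)" using z refl[of z 1 y] by simp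
    moreover have "0 \<le> Im (- cnj z) \<and> M * Im (- cnj z) \<le> 2 * (1 - \<bar>Re (- cnj z)\<bar>)" using z(2) by simp
    ultimately have "- cnj z = -1" using * by blast
    then show "z = 1" by (simp add: complex_eq_iff)
  qed
qed


text \<open>A cell of at most two vertices different from \<open>{a, b}\<close> contains at most one
  of \<open>a\<close> and \<open>b\<close>. So its hull misses the base or is a segment, possibly a
  point, starting at one corner.\<close>

lemma thin_avoids_cell:
  assumes pa: "p a = -1" and pb: "p b = 1"
    and k: "finite k" "card k \<le> 2" "k \<noteq> {a, b}"
    and Int: "convex hull (p ` k) \<inter> closed_segment (-1) 1 \<subseteq> p ` (k \<inter> {a, b})"
  shows "\<forall>\<^sub>F M in at_top. \<forall>z\<in>convex hull (p ` k).
           0 \<le> Im z \<and> M * Im z \<le> 2 * (1 - \<bar>Re z\<bar>) \<longrightarrow> z \<in> p ` (k \<inter> {a, b})"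
proof -
  have ab: "a \<noteq> b" using pa pb by force
  have other: "\<exists>y. k = {x, y}" if "x \<in> k" for x
  proof -
    have "card (k - {x}) \<le> 1" using that k by simp
    then consider "k - {x} = {}" | y where "k - {x} = {y}"
      using k by (metis card_0_eq card_1_singletonE finite_Diff le_less less_one)
    then show ?thesis using that by cases auto
  qed
  show ?thesis
  proof (cases "a \<in> k \<or> b \<in> k")
    case False
    then have "k \<inter> {a, b} = {}" by auto
    moreover have "compact (convex hull (p ` k))"
      using k by (intro compact_convex_hull finite_imp_compact) auto
    ultimately show ?thesis using thin_avoids_disjoint[of "convex hull (p ` k)"] Int
      by (auto elim!: eventually_mono)
  next
    case True
    then show ?thesis
    proof
      assume "a \<in> k"
      then obtain y where y: "k = {a, y}" using other by blast
      then have ki: "k \<inter> {a, b} = {a}" using k(3) by auto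
      have "convex hull (p ` k) = closed_segment (-1) (p y)"
        using y pa by (simp add: segment_convex_hull)
      then show ?thesis using thin_avoids_left[of "p y"] Int ki pa by simp
    next
      assume "b \<in> k"
      then obtain y where y: "k = {b, y}" using other by blast
      then have ki: "k \<inter> {a, b} = {b}" using k(3) by (auto simp: insert_commute)
      have "convex hull (p ` k) = closed_segment 1 (p y)"
        using y pb by (simp add: segment_convex_hull)
      then show ?thesis using thin_avoids_right[of "p y"] Int ki pb by simp
    qed
  qed
qed

section \<open>Attaching a leaf: normal position, stretching and the kite\<close>

lemma straight_normalise:
  assumes "straight p K" "p a \<noteq> p b"
  obtains p' where "straight p' K" "p' a = -1" "p' b = 1"
proof -
  \<comment> \<open>\<open>m\<close> is the midpoint, and multiplication by \<open>s\<close> turns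
    and scales \<open>(p b - p a) / 2\<close> to 1.\<close>
  define m where "m = (p a + p b) / 2"
  define s where "s = 2 / (p b - p a)"
  define F where "F z = s * (- m + z)" for z
  have s: "s \<noteq> 0" using assms by (simp add: s_def)
  have "straight (F \<circ> p) K"
  proof (rule straight_image[OF assms(1)])
    show "inj F" using s by (auto simp: F_def inj_def)
    show "convex hull (F ` A) = F ` (convex hull A)" for A
    proof -
      have F: "F ` B = (*) s ` ((+) (- m) ` B)" for B by (simp add: F_def image_image)
      show ?thesis
        unfolding F by (simp only: convex_hull_linear_image[OF bounded_linear.linear[OF bounded_linear_mult_right], symmetric]
            convex_hull_translation)
    qed
  qed
  moreover have "(F \<circ> p) a = -1" "(F \<circ> p) b = 1"
    using assms(2) by (auto simp: F_def m_def s_def divide_simps)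
  ultimately show ?thesis using that by blast
qed

lemma straight_stretch:
  assumes "straight p K" "M > 0"
  shows "straight (\<lambda>x. Complex (Re (p x)) (M * Im (p x))) K"
    and "convex hull ((\<lambda>x. Complex (Re (p x)) (M * Im (p x))) ` k)
       = (\<lambda>z. Complex (Re z) (M * Im z)) ` (convex hull (p ` k))"
proof -
  let ?F = "\<lambda>z. Complex (Re z) (M * Im z)"
  have "linear ?F" by (rule linearI) (auto simp: complex_eq_iff algebra_simps)
  then have hull: "convex hull (?F ` A) = ?F ` (convex hull A)" for A
    by (rule convex_hull_linear_image[symmetric])
  have "inj ?F" using assms(2) by (auto simp: inj_def complex_eq_iff)
  from straight_image[OF assms(1) this hull]
  show "straight (\<lambda>x. Complex (Re (p x)) (M * Im (p x))) K" by (simp add: comp_def)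
  show "convex hull ((\<lambda>x. Complex (Re (p x)) (M * Im (p x))) ` k) = ?F ` (convex hull (p ` k))"
    using hull[of "p ` k"] by (simp add: image_image)
qed

lemma kite_segments:
  shows "z \<in> convex hull {-1, 2 * \<i>} \<Longrightarrow> Im z = 2 * (1 + Re z) \<and> -1 \<le> Re z \<and> Re z \<le> 0"
    and "z \<in> convex hull {1, 2 * \<i>} \<Longrightarrow> Im z = 2 * (1 - Re z) \<and> 0 \<le> Re z \<and> Re z \<le> 1"
    and "z \<in> convex hull {-1, \<i>} \<Longrightarrow> Im z = 1 + Re z \<and> -1 \<le> Re z \<and> Re z \<le> 0"
    and "z \<in> convex hull {1, \<i>} \<Longrightarrow> Im z = 1 - Re z \<and> 0 \<le> Re z \<and> Re z \<le> 1"
    and "z \<in> convex hull {2 * \<i>, \<i>} \<Longrightarrow> Re z = 0 \<and> 1 \<le> Im z \<and> Im z \<le> 2"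
    and "z \<in> convex hull {-1, 1} \<Longrightarrow> Im z = 0 \<and> -1 \<le> Re z \<and> Re z \<le> 1"
  unfolding segment_convex_hull[symmetric] by (auto simp: in_segment)

text \<open>The complete graph on four vertices, drawn with \<open>d\<close> inside the triangle
  \<open>a\<close>, \<open>b\<close>, \<open>c\<close>; line equations of the segments settle all
  intersections.\<close>

lemma straight_kite:
  assumes p: "p a = -1" "p b = 1" "p c = 2 * \<i>" "p d = \<i>"
  shows "straight p {{a, b}, {c}, {d}, {c, d}, {a, c}, {b, c}, {a, d}, {b, d}}"
proof -
  have dist: "a \<noteq> b" "a \<noteq> c" "a \<noteq> d" "b \<noteq> c" "b \<noteq> d" "c \<noteq> d"
    using p by (auto simp: complex_eq_iff)
  show ?thesis
    unfolding straight_def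
    using dist dist[symmetric]
    by (auto simp: p complex_eq_iff dest!: kite_segments)
qed


text \<open>The inductive step for a leaf: \<open>a\<close>, \<open>b\<close> are the copies of its
  neighbour and \<open>c\<close>, \<open>d\<close> its own. After stretching, the other old cells
  meet the triangle over the segment from \<open>a\<close> to \<open>b\<close> only in its ends, and
  the kite fits into it.\<close>

lemma straight_add_twins:
  assumes K: "straight p K" "finite K" "\<forall>k\<in>K. finite k \<and> card k \<le> 2"
    and ab: "a \<noteq> b" "{a} \<in> K" "{b} \<in> K" "{a, b} \<in> K"
    and new: "c \<noteq> d" "c \<notin> \<Union>K" "d \<notin> \<Union>K"
  shows "\<exists>p'. straight p' (K \<union> {{c}, {d}, {c, d}, {a, c}, {b, c}, {a, d}, {b, d}})"
proof -
  have "p a \<noteq> p b" using straightD[OF K(1) ab(2,3), of "p a"] ab(1) by auto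
  then obtain p0 where p0: "straight p0 K" "p0 a = -1" "p0 b = 1"
    by (rule straight_normalise[OF K(1)])
  have hab: "convex hull (p0 ` {a, b}) = closed_segment (-1) 1"
    using p0 by (simp add: segment_convex_hull)
  have "\<forall>\<^sub>F M in at_top. \<forall>k\<in>K - {{a, b}}. \<forall>z\<in>convex hull (p0 ` k).
           0 \<le> Im z \<and> M * Im z \<le> 2 * (1 - \<bar>Re z\<bar>) \<longrightarrow> z \<in> p0 ` (k \<inter> {a, b})"
  \<comment> \<open>Each cell allows all large \<open>M\<close>; as there are finitely many cells,
    one \<open>M\<close> serves them all.\<close>
  proof (rule eventually_ball_finite, use K in simp, rule ballI)
    fix k assume k: "k \<in> K - {{a, b}}"
    then have "convex hull (p0 ` k) \<inter> closed_segment (-1) 1 \<subseteq> p0 ` (k \<inter> {a, b})"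
      using p0(1) ab(4) hab unfolding straight_def by (metis DiffE singletonI)
    then show "\<forall>\<^sub>F M in at_top. \<forall>z\<in>convex hull (p0 ` k).
           0 \<le> Im z \<and> M * Im z \<le> 2 * (1 - \<bar>Re z\<bar>) \<longrightarrow> z \<in> p0 ` (k \<inter> {a, b})"
      using k K by (intro thin_avoids_cell p0) auto
  qed
  then have "\<forall>\<^sub>F M in at_top. M > 0 \<and> (\<forall>k\<in>K - {{a, b}}. \<forall>z\<in>convex hull (p0 ` k).
           0 \<le> Im z \<and> M * Im z \<le> 2 * (1 - \<bar>Re z\<bar>) \<longrightarrow> z \<in> p0 ` (k \<inter> {a, b}))"
    by (intro eventually_conj eventually_gt_at_top)
  then obtain M where M: "M > 0" and thin: "\<And>k z. k \<in> K - {{a, b}} \<Longrightarrow> z \<in> convex hull (p0 ` k) \<Longrightarrow>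
      0 \<le> Im z \<and> M * Im z \<le> 2 * (1 - \<bar>Re z\<bar>) \<Longrightarrow> z \<in> p0 ` (k \<inter> {a, b})"
    unfolding eventually_at_top_linorder by (metis order_refl)
  define p1 where "p1 x = Complex (Re (p0 x)) (M * Im (p0 x))" for x
  have p1: "straight p1 K" "p1 a = -1" "p1 b = 1"
    using straight_stretch(1)[OF p0(1) M] p0 by (auto simp: p1_def[abs_def] complex_eq_iff)
  have thin1: "z \<in> p1 ` (k \<inter> {a, b})"
    if k: "k \<in> K - {{a, b}}" and z: "z \<in> convex hull (p1 ` k)" and R: "0 \<le> Im z" "Im z \<le> 2 * (1 - \<bar>Re z\<bar>)"
    for k z
  proof -
    obtain y where y: "y \<in> convex hull (p0 ` k)" "z = Complex (Re y) (M * Im y)"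
      using z straight_stretch(2)[OF p0(1) M, of k] unfolding p1_def by auto
    have "0 \<le> Im y" using R(1) y M by (simp add: zero_le_mult_iff)
    then have "y \<in> p0 ` (k \<inter> {a, b})" using thin[OF k y(1)] R y by simp
    then show ?thesis using y by (auto simp: p1_def)
  qed
  define p' where "p' = p1(c := 2 * \<i>, d := \<i>)"
  have old: "p' x = p1 x" if "x \<in> \<Union>K" for x using that new by (auto simp: p'_def)
  have abK: "a \<in> \<Union>K" "b \<in> \<Union>K" using ab by auto
  have p': "p' a = -1" "p' b = 1" "p' c = 2 * \<i>" "p' d = \<i>"
    using old[OF abK(1)] old[OF abK(2)] p1 new by (auto simp: p'_def)
  let ?L = "{{c}, {d}, {c, d}, {a, c}, {b, c}, {a, d}, {b, d}}"
  note kite = straight_kite[of p', OF p']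
  have "straight p' (K \<union> ?L)"
  proof (rule straight_Un)
    show "straight p' K" by (rule straight_cong[OF p1(1)]) (use old in auto)
    show "straight p' ?L" by (rule straight_subset[OF kite]) blast
  next
    fix k l assume k: "k \<in> K" and l: "l \<in> ?L"
    have im: "p' ` k = p1 ` k" using old k by (intro image_cong) auto
    have "l \<noteq> {a, b}" using l new abK by (auto simp: doubleton_eq_iff)
    then have base: "z \<in> p' ` (l \<inter> {a, b})"
      if "z \<in> convex hull (p' ` l)" "z \<in> convex hull (p' ` {a, b})" for z
      using straightD[OF kite, of l "{a, b}" z] l that by blast
    show "convex hull (p' ` k) \<inter> convex hull (p' ` l) \<subseteq> p' ` (k \<inter> l)"
    proof
      fix z assume z: "z \<in> convex hull (p' ` k) \<inter> convex hull (p' ` l)"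
      show "z \<in> p' ` (k \<inter> l)"
      proof (cases "k = {a, b}")
        case True
        then show ?thesis using base z by (simp add: Int_commute)
      next
        case False
        \<comment> \<open>New cells lie in the triangle, where an old cell has only points of
          \<open>a\<close> or \<open>b\<close>. Such a point is on the base, and there the kite
          shows it to be a vertex of \<open>l\<close> as well.\<close>
        have "0 \<le> Im z \<and> Im z \<le> 2 * (1 - \<bar>Re z\<bar>)"
          using z l by (auto simp: p' dest!: kite_segments)
        then have "z \<in> p1 ` (k \<inter> {a, b})" using thin1[of k z] k False z im by auto
        then obtain x where x: "x \<in> k" "x \<in> {a, b}" "z = p1 x" by blast
        then have "z = p' x" using old[of x] k by (metis UnionI)
        note x = x(1,2) this
        then have "z \<in> convex hull (p' ` {a, b})" by (auto intro: hull_inc)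
        then obtain y where y: "y \<in> l" "y \<in> {a, b}" "z = p' y" using base z by blast
        have "x = y" using x y p' by auto
        then show ?thesis using x y by blast
      qed
    qed
  qed
  then show ?thesis by blast
qed

section \<open>From straight segments to plane drawings\<close>

lemma straight_imp_planar:
  assumes G: "simple_graph G" and p: "straight p ((\<lambda>v. {v}) ` verts G \<union> edges G)"
  shows "planar G"
proof -
  have inj: "inj_on p (verts G)"
  proof (rule inj_onI)
    fix x y assume xy: "x \<in> verts G" "y \<in> verts G" "p x = p y"
    show "x = y" using straightD[OF p, of "{x}" "{y}" "p x"] xy by auto
  qed
  have "\<exists>g. arc g \<and> {pathstart g, pathfinish g} = p ` e \<and> path_image g = convex hull (p ` e)"
    if e: "e \<in> edges G" for e
  proof -
    have "card e = 2" "e \<subseteq> verts G" using G e by (auto simp: simple_graph_def)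
    then obtain x y where xy: "e = {x, y}" "x \<noteq> y" by (auto simp: card_2_iff)
    then have "p x \<noteq> p y" using inj \<open>e \<subseteq> verts G\<close> by (auto simp: inj_on_def)
    then show ?thesis using xy
      by (intro exI[of _ "linepath (p x) (p y)"]) (simp add: segment_convex_hull)
  qed
  then obtain \<gamma> where \<gamma>: "\<And>e. e \<in> edges G \<Longrightarrow> arc (\<gamma> e)"
    "\<And>e. e \<in> edges G \<Longrightarrow> {pathstart (\<gamma> e), pathfinish (\<gamma> e)} = p ` e"
    "\<And>e. e \<in> edges G \<Longrightarrow> path_image (\<gamma> e) = convex hull (p ` e)"
    by metis
  have "plane_drawing G p \<gamma>"
    unfolding plane_drawing_def
  proof (intro conjI ballI impI inj)
    fix e assume e: "e \<in> edges G"
    then have ee: "card e = 2" "e \<subseteq> verts G" using G by (auto simp: simple_graph_def)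
    show "arc (\<gamma> e)" "{pathstart (\<gamma> e), pathfinish (\<gamma> e)} = p ` e" using \<gamma> e by auto
    show "path_image (\<gamma> e) \<inter> p ` verts G = p ` e"
    proof
      show "p ` e \<subseteq> path_image (\<gamma> e) \<inter> p ` verts G"
        using ee \<gamma>(3)[OF e] hull_subset[of "p ` e" convex] by auto
      show "path_image (\<gamma> e) \<inter> p ` verts G \<subseteq> p ` e"
      proof
        fix z assume z: "z \<in> path_image (\<gamma> e) \<inter> p ` verts G"
        then obtain v where v: "v \<in> verts G" "z = p v" by blast
        have "e \<noteq> {v}" using ee by auto
        then show "z \<in> p ` e" using straightD[OF p, of e "{v}" z] e v z \<gamma>(3)[OF e] by auto
      qed
    qed
  next
    fix e f assume "e \<in> edges G" "f \<in> edges G" "e \<noteq> f"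
    then show "path_image (\<gamma> e) \<inter> path_image (\<gamma> f) \<subseteq> p ` (e \<inter> f)"
      using straightD[OF p, of e f] \<gamma>(3) by auto
  qed
  then show ?thesis by (auto simp: planar_def)
qed

section \<open>Doubled forests and the theorem\<close>

text \<open>Besides the cells of the doubled graph it contains the segment between the two copies of
  each vertex. This strengthens the induction: no other cell crosses such a segment, so a leaf can
  be attached over it.\<close>

definition twin_complex :: "'a set \<Rightarrow> 'a set set \<Rightarrow> ('a \<times> bool) set set" where
  "twin_complex V E = (\<lambda>v. {v}) ` (V \<times> UNIV)
     \<union> {{(a, x), (b, y)} | a b x y. {a, b} \<in> E}
     \<union> (\<lambda>w. {(w, True), (w, False)}) ` V"

lemma finite_twin_complex:
  assumes "finite V" "\<forall>e\<in>E. e \<subseteq> V"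
  shows "finite (twin_complex V E)"
proof (rule finite_subset)
  show "twin_complex V E \<subseteq> Pow (V \<times> UNIV)" using assms(2) by (fastforce simp: twin_complex_def)
qed (use assms in simp)

lemma twin_complex_cell: "k \<in> twin_complex V E \<Longrightarrow> finite k \<and> card k \<le> 2"
  by (auto simp: twin_complex_def card_insert_if)

lemma Union_twin_complex:
  assumes "\<forall>e\<in>E. e \<subseteq> V"
  shows "\<Union>(twin_complex V E) \<subseteq> V \<times> UNIV"
  using assms by (fastforce simp: twin_complex_def)

lemma twin_complex_isolated:
  assumes "w \<in> V"
  shows "twin_complex V {} = twin_complex (V - {w}) {} \<union>
     {{(w, True)}, {(w, False)}, {(w, True), (w, False)}}"
proof -
  define U where "U = V - {w}"
  have U: "V = insert w U" using assms by (auto simp: U_def)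
  show ?thesis unfolding U_def[symmetric] unfolding U
    by (auto simp: twin_complex_def UNIV_bool)
qed

text \<open>Arranged to fit \<open>straight_add_twins\<close>, with the copies of \<open>x\<close>
  as \<open>a\<close>, \<open>b\<close> and those of \<open>w\<close> as \<open>c\<close>,
  \<open>d\<close>.\<close>

lemma twin_complex_leaf:
  assumes "w \<in> V" "{w, x} \<in> E"
  shows "twin_complex V E = twin_complex (V - {w}) (E - {{w, x}}) \<union>
     {{(w, True)}, {(w, False)}, {(w, True), (w, False)}, {(x, True), (w, True)},
      {(x, False), (w, True)}, {(x, True), (w, False)}, {(x, False), (w, False)}}"
proof -
  define U where "U = V - {w}"
  define F where "F = E - {{w, x}}"
  have U: "V = insert w U" and F: "E = insert {w, x} F" using assms by (auto simp: U_def F_def)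
  have "{{(a, i), (b, j)} | a b i j. {a, b} \<in> insert {w, x} F} =
     {{(a, i), (b, j)} | a b i j. {a, b} \<in> F} \<union> {{(x, i), (w, j)} | i j. True}"
    (is "?L = ?R")
  proof (intro equalityI subsetI)
    fix k assume "k \<in> ?L"
    then obtain a b i j where k: "k = {(a, i), (b, j)}" "{a, b} \<in> F \<or> {a, b} = {w, x}" by blast
    then consider "{a, b} \<in> F" | "a = w" "b = x" | "a = x" "b = w" by (auto simp: doubleton_eq_iff)
    then show "k \<in> ?R"
    proof cases
      case 2
      then have "k = {(x, j), (w, i)}" using k by blast
      then show ?thesis by blast
    qed (use k in blast)+
  next
    fix k assume "k \<in> ?R"
    then consider a b i j where "k = {(a, i), (b, j)}" "{a, b} \<in> F"
      | i j where "k = {(x, i), (w, j)}" by blast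
    then show "k \<in> ?L"
    proof cases
      case (2 i j)
      moreover have "{x, w} \<in> insert {w, x} F" by (simp add: insert_commute)
      ultimately show ?thesis by blast
    qed blast
  qed
  also have "{{(x, i), (w, j)} | i j. True} = {{(x, True), (w, True)},
      {(x, False), (w, True)}, {(x, True), (w, False)}, {(x, False), (w, False)}}"
    by (rule set_eqI) (simp add: ex_bool_eq, blast)
  finally have *: "{{(a, i), (b, j)} | a b i j. {a, b} \<in> insert {w, x} F} =
     {{(a, i), (b, j)} | a b i j. {a, b} \<in> F} \<union> {{(x, True), (w, True)},
      {(x, False), (w, True)}, {(x, True), (w, False)}, {(x, False), (w, False)}}" .
  show ?thesis unfolding U_def[symmetric] F_def[symmetric] unfolding U F twin_complex_def *
    by (auto simp: UNIV_bool)
qed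

text \<open>Leaves are removed as long as there are edges and are put back over the segment of their
  neighbour; the remaining isolated vertices are placed far out.\<close>

lemma twin_complex_straight:
  assumes "finite V" "\<forall>e\<in>E. e \<subseteq> V \<and> card e = 2" "acyclic_edges E"
  shows "\<exists>p. straight p (twin_complex V E)"
  using assms
proof (induction "card V" arbitrary: V E rule: less_induct)
  case less
  have finE: "finite E" using less.prems(1,2) finite_subset[of E "Pow V"] by blast
  have two: "\<forall>e\<in>E. card e = 2" using less.prems(2) by blast
  show ?case
  proof (cases "E = {}")
    case True
    show ?thesis
    proof (cases "V = {}")
      case True
      then show ?thesis using \<open>E = {}\<close> by (simp add: twin_complex_def straight_def)
    next
      case False
      then obtain w where w: "w \<in> V" by blast
      have "card (V - {w}) < card V" by (rule card_Diff1_less[OF less.prems(1) w])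
      then obtain p where p: "straight p (twin_complex (V - {w}) {})"
        using less.hyps[of "V - {w}" "{}"] less.prems(1,3) True by auto
      have "\<Union>(twin_complex (V - {w}) {}) \<subseteq> (V - {w}) \<times> UNIV" by (rule Union_twin_complex) simp
      then show ?thesis
        unfolding True twin_complex_isolated[OF w]
        using less.prems(1)
        by (intro straight_add_far_pair[OF p] finite_twin_complex ballI)
          (auto dest: twin_complex_cell)
    qed
  next
    case False
    obtain w x where w: "w \<noteq> x" "{w, x} \<in> E" "\<forall>f\<in>E. w \<in> f \<longrightarrow> f = {w, x}"
      by (rule acyclic_edges_leaf[OF finE two False less.prems(3)])
    have wV: "w \<in> V" "x \<in> V" using w(2) less.prems(2) by auto
    let ?V = "V - {w}" and ?E = "E - {{w, x}}"
    have "w \<notin> f" if "f \<in> ?E" for f using w(3) that by blast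
    then have E': "\<forall>e\<in>?E. e \<subseteq> ?V \<and> card e = 2" using less.prems(2) by blast
    have "card ?V < card V" by (rule card_Diff1_less[OF less.prems(1) wV(1)])
    then obtain p where p: "straight p (twin_complex ?V ?E)"
      using less.hyps[of ?V ?E] E' less.prems(1) acyclic_edges_subset[OF less.prems(3), of ?E] by auto
    have U: "\<Union>(twin_complex ?V ?E) \<subseteq> ?V \<times> UNIV" using E' by (intro Union_twin_complex) blast
    show ?thesis
      unfolding twin_complex_leaf[OF wV(1) w(2)]
    proof (rule straight_add_twins[OF p])
      show "finite (twin_complex ?V ?E)" using E' less.prems(1) by (intro finite_twin_complex) auto
      show "\<forall>k\<in>twin_complex ?V ?E. finite k \<and> card k \<le> 2" using twin_complex_cell by blast
      show "{(x, True)} \<in> twin_complex ?V ?E" "{(x, False)} \<in> twin_complex ?V ?E"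
        "{(x, True), (x, False)} \<in> twin_complex ?V ?E"
        using wV w(1) by (auto simp: twin_complex_def)
    qed (use U in auto)
  qed
qed

section \<open>The graph \<open>bowtie G\<close>\<close>

lemma doubleton_in_edges_bowtie:
  "{(a, x), (b, y)} \<in> edges (bowtie G) \<longleftrightarrow> {a, b} \<in> edges G"
  by (auto simp: bowtie_def doubleton_eq_iff insert_commute)

lemma in_edges_bowtie:
  "k \<in> edges (bowtie G) \<longleftrightarrow> (\<exists>a b x y. k = {(a, x), (b, y)} \<and> {a, b} \<in> edges G)"
  by (auto simp: bowtie_def)

lemma verts_bowtie: "verts (bowtie G) = verts G \<times> UNIV"
  by (simp add: bowtie_def)

lemma simple_graph_bowtie:
  assumes "simple_graph G"
  shows "simple_graph (bowtie G)"
proof -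
  have "{(a, x), (b, y)} \<subseteq> verts G \<times> UNIV \<and> card {(a, x), (b, y)} = 2" if "{a, b} \<in> edges G" for a b x y
  proof -
    have "card {a, b} = 2" "{a, b} \<subseteq> verts G" using assms that by (auto simp: simple_graph_def)
    then show ?thesis by (cases "a = b") auto
  qed
  then show ?thesis using assms unfolding simple_graph_def bowtie_def by fastforce
qed

lemma subgraph_bowtie:
  assumes "subgraph H G"
  shows "subgraph (bowtie H) (bowtie G)"
  using assms simple_graph_bowtie[of H] by (auto simp: subgraph_def bowtie_def)

lemma le_girth_iff: "g \<le> girth H \<longleftrightarrow> (\<forall>c. cycle_in (edges H) c \<longrightarrow> g \<le> enat (length c))"
  by (auto simp: girth_def le_INF_iff is_cycle_iff_cycle_in)

lemma girth_eq_infinity_iff: "girth H = \<infinity> \<longleftrightarrow> acyclic_edges (edges H)"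
  using le_girth_iff[of \<infinity> H] by (simp add: acyclic_edges_def)

lemma four_le_girth_iff: "4 \<le> girth H \<longleftrightarrow> (\<forall>c. cycle_in (edges H) c \<longrightarrow> 4 \<le> length c)"
  by (simp add: le_girth_iff numeral_eq_enat)

lemma planar_bowtie_forest:
  assumes "simple_graph H" "acyclic_edges (edges H)"
  shows "planar (bowtie H)"
proof -
  obtain p where "straight p (twin_complex (verts H) (edges H))"
    using twin_complex_straight[of "verts H" "edges H"] assms by (auto simp: simple_graph_def)
  then have "straight p ((\<lambda>v. {v}) ` verts (bowtie H) \<union> edges (bowtie H))"
    by (rule straight_subset) (auto simp: twin_complex_def bowtie_def)
  then show ?thesis by (rule straight_imp_planar[OF simple_graph_bowtie[OF assms(1)]])
qed

text \<open>In a triangle all pairs are adjacent, and adjacent vertices are copies of different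
  vertices of \<open>H\<close>. So a triangle would project to a triangle in the forest.\<close>

lemma girth_bowtie_forest:
  assumes "simple_graph H" "acyclic_edges (edges H)"
  shows "4 \<le> girth (bowtie H)"
  unfolding four_le_girth_iff
proof (intro allI impI)
  fix c assume c: "cycle_in (edges (bowtie H)) c"
  show "4 \<le> length c"
  proof (rule ccontr)
    assume "\<not> 4 \<le> length c"
    then have len: "length c = 3" using c by (simp add: cycle_in_def)
    have adj: "{fst (c ! i), fst (c ! (Suc i mod 3))} \<in> edges H" if "i < 3" for i
      using c that doubleton_in_edges_bowtie[of "fst (c ! i)" "snd (c ! i)"
          "fst (c ! (Suc i mod 3))" "snd (c ! (Suc i mod 3))" H] by (simp add: cycle_in_def len)
    let ?xs = "map fst c"
    have ne: "fst (c ! i) \<noteq> fst (c ! (Suc i mod 3))" if "i < 3" for i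
      using adj[OF that] assms(1) by (auto simp: simple_graph_def)
    obtain u v w where "c = [u, v, w]" using len by (auto simp: numeral_3_eq_3 length_Suc_conv)
    then have "distinct ?xs" using ne[of 0] ne[of 1] ne[of 2] by auto
    then have "cycle_in (edges H) ?xs" using adj by (simp add: cycle_in_def len)
    then show False using assms(2) by (auto simp: acyclic_edges_def)
  qed
qed

text \<open>Once each edge of \<open>G\<close> is oriented, the four choices of copies at its ends
  give distinct edges, and projection recovers the edge of \<open>G\<close>.\<close>

lemma card_edges_bowtie:
  assumes G: "simple_graph G"
  shows "4 * card (edges G) \<le> card (edges (bowtie G))"
proof -
  have "\<exists>s t. e = {s, t} \<and> s \<noteq> t" if "e \<in> edges G" for e
    using G that by (auto simp: simple_graph_def card_2_iff)
  then obtain s t where st: "\<And>e. e \<in> edges G \<Longrightarrow> e = {s e, t e} \<and> s e \<noteq> t e" by metis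
  define f where "f = (\<lambda>(e, x, y). {(s e, x), (t e, y)} :: ('a \<times> bool) set)"
  have "inj_on f (edges G \<times> UNIV)"
  proof (rule inj_onI)
    fix u v assume u: "u \<in> edges G \<times> UNIV" and v: "v \<in> edges G \<times> UNIV" and eq: "f u = f v"
    obtain e x y e' x' y' where uv: "u = (e, x, y)" "v = (e', x', y')" by (metis surj_pair)
    have ee: "e \<in> edges G" "e' \<in> edges G" using u v uv by auto
    have "fst ` f u = e" "fst ` f v = e'" using st[OF ee(1)] st[OF ee(2)] uv by (auto simp: f_def)
    then have e': "e' = e" using eq by simp
    then show "u = v" using eq uv st[OF ee(1)] by (auto simp: f_def doubleton_eq_iff)
  qed
  moreover have "f ` (edges G \<times> UNIV) \<subseteq> edges (bowtie G)"
    using st by (auto simp: f_def doubleton_in_edges_bowtie)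
  moreover have "finite (edges (bowtie G))"
    using simple_graph_bowtie[OF G] finite_subset[of "edges (bowtie G)" "Pow (verts (bowtie G))"]
    by (auto simp: simple_graph_def)
  ultimately have "card (edges G \<times> (UNIV :: (bool \<times> bool) set)) \<le> card (edges (bowtie G))"
    by (metis card_inj_on_le)
  moreover have "card (UNIV :: (bool \<times> bool) set) = 4" by (simp add: card_cartesian_product flip: UNIV_Times_UNIV)
  ultimately show ?thesis by (simp add: card_cartesian_product)
qed

section \<open>Covers and the two bounds\<close>

definition girth_cover :: "enat \<Rightarrow> 'a graph \<Rightarrow> 'a graph set \<Rightarrow> bool" where
  "girth_cover g G \<H> \<longleftrightarrow> finite \<H> \<and>
     (\<forall>H\<in>\<H>. subgraph H G \<and> planar H \<and> g \<le> girth H) \<and>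
     (\<Union>H\<in>\<H>. verts H) = verts G \<and> (\<Union>H\<in>\<H>. edges H) = edges G"

lemma girth_thickness_conv:
  "girth_thickness g G = (LEAST k. \<exists>\<H>. girth_cover g G \<H> \<and> card \<H> = k)"
  unfolding girth_thickness_def girth_cover_def by (rule arg_cong[of _ _ Least]) (auto simp: fun_eq_iff)

text \<open>\<open>LEAST\<close> is sure to be attained only if some cover exists, and the
  assumption supplies one.\<close>

lemma girth_thickness_attained:
  assumes "girth_cover g G \<H>'"
  obtains \<H> where "girth_cover g G \<H>" "card \<H> = girth_thickness g G"
  using LeastI_ex[of "\<lambda>k. \<exists>\<H>. girth_cover g G \<H> \<and> card \<H> = k"] assms that
  unfolding girth_thickness_conv by blast

lemma girth_thickness_le: "girth_cover g G \<H> \<Longrightarrow> girth_thickness g G \<le> card \<H>"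
  unfolding girth_thickness_conv by (rule Least_le) blast

lemma acyclic_edges_single: "acyclic_edges E" if "\<exists>e. E \<subseteq> {e}"
proof -
  have "card (cycle_edges c) \<le> 1" if "cycle_edges c \<subseteq> E" for c
    using \<open>\<exists>e. E \<subseteq> {e}\<close> that by (metis card.empty card_mono finite.emptyI finite.insertI
        is_singletonI is_singleton_altdef order_trans)
  then show ?thesis by (fastforce simp: acyclic_edges_def cycle_in_iff card_cycle_edges)
qed

lemma planar_single_edge:
  assumes "x \<noteq> y"
  shows "planar \<lparr>verts = {x, y}, edges = {{x, y}}\<rparr>"
proof -
  define p where "p = (\<lambda>v. if v = x then 0 else (1::complex))"
  have "plane_drawing \<lparr>verts = {x, y}, edges = {{x, y}}\<rparr> p (\<lambda>_. linepath 0 1)"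
    using assms by (auto simp: plane_drawing_def p_def)
  then show ?thesis by (auto simp: planar_def)
qed

lemma forest_cover_exists:
  assumes G: "simple_graph G"
  shows "\<exists>\<H>. girth_cover \<infinity> G \<H>"
proof -
  define \<H> where "\<H> = (\<lambda>v. \<lparr>verts = {v}, edges = {}\<rparr>) ` verts G \<union> (\<lambda>e. \<lparr>verts = e, edges = {e}\<rparr>) ` edges G"
  have fin: "finite (verts G)" "finite (edges G)"
    using G finite_subset[of "edges G" "Pow (verts G)"] by (auto simp: simple_graph_def)
  have sub: "e \<subseteq> verts G" "card e = 2" if "e \<in> edges G" for e
    using G that by (auto simp: simple_graph_def)
  have "subgraph H G \<and> planar H \<and> \<infinity> \<le> girth H" if "H \<in> \<H>" for H
  proof -
    from that consider v where "v \<in> verts G" "H = \<lparr>verts = {v}, edges = {}\<rparr>"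
      | e where "e \<in> edges G" "H = \<lparr>verts = e, edges = {e}\<rparr>" by (auto simp: \<H>_def)
    then show ?thesis
    proof cases
      case 1
      then show ?thesis
        by (auto simp: subgraph_def simple_graph_def planar_def plane_drawing_def
            girth_eq_infinity_iff intro!: acyclic_edges_single)
    next
      case 2
      obtain x y where "e = {x, y}" "x \<noteq> y" using sub[OF 2(1)] by (auto simp: card_2_iff)
      then have "planar H" using 2 planar_single_edge by simp
      moreover have "finite e" using sub[OF 2(1)] fin finite_subset by blast
      ultimately show ?thesis using 2 sub
        by (auto simp: subgraph_def simple_graph_def girth_eq_infinity_iff intro!: acyclic_edges_single)
    qed
  qed
  then have "girth_cover \<infinity> G \<H>" using fin sub by (fastforce simp: girth_cover_def \<H>_def)
  then show ?thesis by blast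
qed

text \<open>\<open>bowtie\<close> respects unions of vertex sets and of edge sets, so doubling each
  forest of a cover gives a cover.\<close>

lemma girth_cover_bowtie:
  assumes "girth_cover \<infinity> G \<H>"
  shows "girth_cover 4 (bowtie G) (bowtie ` \<H>)"
proof -
  have H: "subgraph H G \<and> simple_graph H \<and> acyclic_edges (edges H)" if "H \<in> \<H>" for H
    using assms that by (auto simp: girth_cover_def girth_eq_infinity_iff subgraph_def)
  have V: "(\<Union>H\<in>\<H>. verts H) = verts G" and E: "(\<Union>H\<in>\<H>. edges H) = edges G"
    using assms by (auto simp: girth_cover_def)
  have "(\<Union>H\<in>bowtie ` \<H>. verts H) = verts (bowtie G)"
    using V by (auto simp: verts_bowtie)
  moreover have "(\<Union>H\<in>bowtie ` \<H>. edges H) = edges (bowtie G)"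
    by (rule set_eqI) (simp add: in_edges_bowtie E[symmetric], blast)
  moreover have "subgraph (bowtie H) (bowtie G) \<and> planar (bowtie H) \<and> 4 \<le> girth (bowtie H)"
    if "H \<in> \<H>" for H
    using H[OF that] subgraph_bowtie planar_bowtie_forest girth_bowtie_forest by blast
  moreover have "finite \<H>" using assms by (simp add: girth_cover_def)
  ultimately show ?thesis by (simp add: girth_cover_def)
qed

text \<open>A member of a cover may have few vertices. With fewer than three it has at most one
  edge, and \<open>4 \<le> N\<close> suffices.\<close>

lemma card_edges_le_girth_4:
  assumes H: "simple_graph H" "planar H" "4 \<le> girth H" and N: "card (verts H) \<le> N" "4 \<le> N"
  shows "card (edges H) + 4 \<le> 2 * N"
proof (cases "3 \<le> card (verts H)")
  case True
  obtain p \<gamma> where "plane_drawing H p \<gamma>" using H by (auto simp: planar_def)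
  then interpret plane_graph H p \<gamma> using H by unfold_locales
  have "card (edges H) + 4 \<le> 2 * card (verts H)"
    using card_edges_triangle_free H(3) True by (simp add: four_le_girth_iff)
  then show ?thesis using N by linarith
next
  case False
  have "e = verts H" if "e \<in> edges H" for e
    using H(1) that False by (intro card_seteq) (auto simp: simple_graph_def)
  then have "edges H \<subseteq> {verts H}" by blast
  then have "card (edges H) \<le> 1" using card_mono[of "{verts H}"] by simp
  then show ?thesis using N by linarith
qed

text \<open>With at most \<open>2 * n\<close> vertices each member has at most
  \<open>4 * n - 4\<close> edges, while at least \<open>4 * e\<close> edges are to be covered; the
  factor 4 cancels.\<close>

lemma card_edges_le_girth_cover:
  assumes G: "simple_graph G" and n: "2 \<le> card (verts G)" and \<H>: "girth_cover 4 (bowtie G) \<H>"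
  shows "card (edges G) \<le> card \<H> * (card (verts G) - 1)"
proof -
  let ?n = "card (verts G)"
  have fin: "finite (verts (bowtie G))" using simple_graph_bowtie[OF G] by (simp add: simple_graph_def)
  have each: "card (edges H) \<le> 4 * (?n - 1)" if "H \<in> \<H>" for H
  proof -
    have H: "simple_graph H" "planar H" "4 \<le> girth H" "verts H \<subseteq> verts (bowtie G)"
      using \<H> that by (auto simp: girth_cover_def subgraph_def)
    have "card (verts H) \<le> card (verts (bowtie G))" by (rule card_mono[OF fin H(4)])
    also have "\<dots> = 2 * ?n" by (simp add: verts_bowtie card_cartesian_product)
    finally have "card (edges H) + 4 \<le> 2 * (2 * ?n)"
      using n by (intro card_edges_le_girth_4 H) auto
    then show ?thesis by simp
  qed
  have "4 * card (edges G) \<le> card (edges (bowtie G))" by (rule card_edges_bowtie[OF G])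
  also have "\<dots> = card (\<Union>H\<in>\<H>. edges H)" using \<H> by (simp add: girth_cover_def)
  also have "\<dots> \<le> (\<Sum>H\<in>\<H>. card (edges H))" using \<H> by (intro card_UN_le) (simp add: girth_cover_def)
  also have "\<dots> \<le> (\<Sum>H\<in>\<H>. 4 * (?n - 1))" by (intro sum_mono each)
  finally show ?thesis by simp
qed

theorem theorem1:
  fixes G :: "'a graph" and n e :: nat
  assumes "simple_graph G"
    and "n = card (verts G)" and "e = card (edges G)"
    and "n \<ge> 2"
  shows "\<lceil>real e / (real n - 1)\<rceil> \<le> int (girth_thickness 4 (bowtie G)) \<and>
         girth_thickness 4 (bowtie G) \<le> girth_thickness \<infinity> G"
proof -
  obtain \<F> where "girth_cover \<infinity> G \<F>" using forest_cover_exists[OF assms(1)] by blast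
  then obtain \<H> where \<H>: "girth_cover \<infinity> G \<H>" "card \<H> = girth_thickness \<infinity> G"
    by (rule girth_thickness_attained)
  have bow: "girth_cover 4 (bowtie G) (bowtie ` \<H>)" by (rule girth_cover_bowtie[OF \<H>(1)])
  have "girth_thickness 4 (bowtie G) \<le> card (bowtie ` \<H>)" by (rule girth_thickness_le[OF bow])
  also have "\<dots> \<le> card \<H>" using \<H>(1) by (intro card_image_le) (simp add: girth_cover_def)
  finally have upper: "girth_thickness 4 (bowtie G) \<le> girth_thickness \<infinity> G" using \<H>(2) by simp
  \<comment> \<open>The doubled forests also witness that a cover of girth at least 4 exists, so the
    minimum on the left is attained.\<close>
  obtain \<K> where \<K>: "girth_cover 4 (bowtie G) \<K>" "card \<K> = girth_thickness 4 (bowtie G)"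
    by (rule girth_thickness_attained[OF bow])
  have "e \<le> girth_thickness 4 (bowtie G) * (n - 1)"
    using card_edges_le_girth_cover[OF assms(1) _ \<K>(1)] \<K>(2) assms(2-4) by simp
  then have "real e \<le> real (girth_thickness 4 (bowtie G) * (n - 1))" by (rule of_nat_mono)
  \<comment> \<open>Subtraction on naturals is truncated; \<open>n \<ge> 2\<close> makes it agree
    with the real difference and the divisor positive.\<close>
  also have "\<dots> = real (girth_thickness 4 (bowtie G)) * (real n - 1)"
    using assms(4) by (simp add: of_nat_diff)
  finally have "real e / (real n - 1) \<le> real (girth_thickness 4 (bowtie G))"
    using assms(4) by (simp add: divide_le_eq)
  then have "\<lceil>real e / (real n - 1)\<rceil> \<le> int (girth_thickness 4 (bowtie G))"
    by (simp add: ceiling_le_iff)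
  with upper show ?thesis by blast
qed

end
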